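(* Let $\Gamma$ be a $2$-walk-regular graph with valency $k$ and distinct eigenvalues $k=\theta_0>\theta_1>\cdots>\theta_d$. Then $$\Bigl(\theta_1+\frac{k}{a_1+1}\Bigr)\Bigl(\theta_d+\frac{k}{a_1+1}\Bigr)\geq -\frac{k a_1 b_1}{(a_1+1)^2}.$$ If $a_1\neq 0$, equality holds if and only if for every vertex $x$ the subgraph induced on the neighbors of $x$ is strongly regular with eigenvalues $a_1$, $-1-\frac{b_1}{\theta_d+1}$ and $-1-\frac{b_1}{\theta_1+1}$. If $a_1=0$, equality holds if and only if $\Gamma$ is bipartite.
   Context: All graphs are finite, simple and connected. A graph is $2$-walk-regular if it has diameter at least $2$ and for every $\ell\geq0$ the number of walks of length $\ell$ between $x$ and $y$ depends only on $\mathrm{dist}(x,y)$ whenever $\mathrm{dist}(x,y)\leq 2$. Such a graph is regular with valency $k$; for adjacent $x,y$, $a_1$ is the (constant) number of common neighbors and $b_1=k-1-a_1$. Eigenvalues are those of adjacency matrices. *)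

theory Defs
  imports
    "Graph_Theory.Graph_Theory"
    "Jordan_Normal_Form.Spectral_Radius"
begin

text \<open>Simple graphs are the loop-free, symmetric, finite digraphs without parallel arcs of the
  locale \<^locale>\<open>graph\<close>, so an undirected edge is a pair of opposite arcs.\<close>

definition graph_dist :: "('a, 'b) pre_digraph \<Rightarrow> 'a \<Rightarrow> 'a \<Rightarrow> ereal" where
  "graph_dist G u v = wf_digraph.\<mu> G (\<lambda>_. 1) u v"

definition diameter :: "('a, 'b) pre_digraph \<Rightarrow> ereal" where
  "diameter G = (SUP (u, v) \<in> verts G \<times> verts G. graph_dist G u v)"

text \<open>Since a member of \<^locale>\<open>graph\<close> has no parallel arcs, its arc walks correspond one-to-one to
  its walks as vertex sequences.\<close>

definition num_walks :: "('a, 'b) pre_digraph \<Rightarrow> nat \<Rightarrow> 'a \<Rightarrow> 'a \<Rightarrow> nat" where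
  "num_walks G l u v = card {p. pre_digraph.awalk G u p v \<and> length p = l}"

text \<open>The constant \<open>connected\<close> is qualified because of the topological notion of the same name.\<close>

definition two_walk_regular :: "('a, 'b) pre_digraph \<Rightarrow> bool" where
  "two_walk_regular G \<longleftrightarrow>
     graph G \<and> Digraph_Component.connected G \<and> diameter G \<ge> 2 \<and>
     (\<forall>l. \<forall>x \<in> verts G. \<forall>y \<in> verts G. \<forall>x' \<in> verts G. \<forall>y' \<in> verts G.
        graph_dist G x y \<le> 2 \<and> graph_dist G x' y' = graph_dist G x y \<longrightarrow>
        num_walks G l x' y' = num_walks G l x y)"

definition neighbors :: "('a, 'b) pre_digraph \<Rightarrow> 'a \<Rightarrow> 'a set" where
  "neighbors G x = {y \<in> verts G. x \<rightarrow>\<^bsub>G\<^esub> y}"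

definition regular_of_valency :: "('a, 'b) pre_digraph \<Rightarrow> nat \<Rightarrow> bool" where
  "regular_of_valency G k \<longleftrightarrow> (\<forall>x \<in> verts G. card (neighbors G x) = k)"

definition common_neighbors :: "('a, 'b) pre_digraph \<Rightarrow> 'a \<Rightarrow> 'a \<Rightarrow> 'a set" where
  "common_neighbors G x y = neighbors G x \<inter> neighbors G y"

definition local_graph :: "('a, 'b) pre_digraph \<Rightarrow> 'a \<Rightarrow> ('a, 'b) pre_digraph" where
  "local_graph G x = G \<restriction> neighbors G x"

text \<open>As is standard, complete and edgeless graphs are not counted as strongly regular;
  connectedness is not required.\<close>

definition strongly_regular :: "('a, 'b) pre_digraph \<Rightarrow> bool" where
  "strongly_regular G \<longleftrightarrow>
     graph G \<and>
     (\<exists>x \<in> verts G. \<exists>y \<in> verts G. x \<rightarrow>\<^bsub>G\<^esub> y) \<and>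
     (\<exists>x \<in> verts G. \<exists>y \<in> verts G. x \<noteq> y \<and> \<not> x \<rightarrow>\<^bsub>G\<^esub> y) \<and>
     (\<exists>k l m. regular_of_valency G k \<and>
        (\<forall>x \<in> verts G. \<forall>y \<in> verts G. x \<rightarrow>\<^bsub>G\<^esub> y \<longrightarrow>
           card (common_neighbors G x y) = l) \<and>
        (\<forall>x \<in> verts G. \<forall>y \<in> verts G. x \<noteq> y \<and> \<not> x \<rightarrow>\<^bsub>G\<^esub> y \<longrightarrow>
           card (common_neighbors G x y) = m))"

definition bipartite :: "('a, 'b) pre_digraph \<Rightarrow> bool" where
  "bipartite G \<longleftrightarrow>
     (\<exists>U V. verts G = U \<union> V \<and> U \<inter> V = {} \<and> arcs_ends G \<subseteq> U \<times> V \<union> V \<times> U)"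

text \<open>Matrices are indexed by natural numbers, so the vertices have to be enumerated. Another
  enumeration conjugates the adjacency matrix by a permutation matrix, which does not affect its
  eigenvalues. As the matrix is real symmetric, its real spectrum is its full spectrum.\<close>

definition vertex_list :: "('a, 'b) pre_digraph \<Rightarrow> 'a list" where
  "vertex_list G = (SOME xs. distinct xs \<and> set xs = verts G)"

definition adjacency_matrix :: "('a, 'b) pre_digraph \<Rightarrow> real mat" where
  "adjacency_matrix G =
     (let xs = vertex_list G; n = length xs
      in mat n n (\<lambda>(i, j). if (xs ! i) \<rightarrow>\<^bsub>G\<^esub> (xs ! j) then 1 else 0))"

definition graph_spectrum :: "('a, 'b) pre_digraph \<Rightarrow> real set" where
  "graph_spectrum G = spectrum (adjacency_matrix G)"

end

(*
  For an eigenvalue theta other than k, the projection E onto its eigenspace is a polynomial in the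
  adjacency matrix A, so by 2-walk-regularity its entries at distances 0, 1, 2 are constants, and
  A E = theta E determines them up to scaling.  Restricting the positive semidefinite matrix E to
  the neighbours of a vertex and to vectors w with coordinate sum 0 gives
  (theta + 1 + b1) |w|^2 + (theta + 1) <w, B w> >= 0, where B is the adjacency matrix of the local
  graph.  With theta = theta_1 and theta = theta_d this says that on such vectors B lies between
  lo = -1 - b1/(theta_1 + 1) and hi = -1 - b1/(theta_d + 1), so (B - lo)(B - hi) is negative
  semidefinite there.  Its value at the projection of a unit vector is, up to a negative factor, the
  difference of the two sides of the claimed bound; equality means that (B - lo)(B - hi) vanishes on
  the vectors with coordinate sum 0.
*)
theory Submission
  imports Defs
begin

text \<open>Two neighbours of a vertex are at distance at most 2, so on a neighbourhood E is a
  combination of the identity, the local adjacency matrix and the all-ones matrix; on vectors with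
  coordinate sum 0 the last one drops out. Dividing by \<theta>1 + 1 and \<theta>d + 1 requires
  their signs. Both \<theta>1 \<ge> 0 and \<theta>d < -1 come from an induced path on three
  vertices, which exists because the diameter is at least 2 and which also gives b1 > 0. The two
  sides of the bound do not depend on the chosen vertex, so equality for one neighbourhood is
  equality for all of them. The delicate point of the equality case is that a1 may coincide with hi,
  as happens for disconnected local graphs; then a1 is a double root of the cubic with the three
  prescribed eigenvalues as roots. Vectors are functions on a vertex set, so that the graph and all
  its neighbourhoods share one matrix and one spectral theorem.\<close>

section \<open>Real symmetric matrices indexed by a finite set\<close>

locale symmetric_matrix =
  fixes V :: "'v set" and a :: "'v \<Rightarrow> 'v \<Rightarrow> real"
  assumes finite_V [simp]: "finite V"
    and sym: "x \<in> V \<Longrightarrow> y \<in> V \<Longrightarrow> a x y = a y x"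
begin

definition app :: "('v \<Rightarrow> real) \<Rightarrow> 'v \<Rightarrow> real" where
  "app v = (\<lambda>x. \<Sum>y\<in>V. a x y * v y)"

definition shift :: "real \<Rightarrow> ('v \<Rightarrow> real) \<Rightarrow> 'v \<Rightarrow> real" where
  "shift s v = (\<lambda>x. app v x - s * v x)"

definition ip :: "('v \<Rightarrow> real) \<Rightarrow> ('v \<Rightarrow> real) \<Rightarrow> real" where
  "ip u v = (\<Sum>x\<in>V. u x * v x)"

definition eigvec :: "real \<Rightarrow> ('v \<Rightarrow> real) \<Rightarrow> bool" where
  "eigvec s v \<longleftrightarrow> (\<forall>x\<in>V. app v x = s * v x)"

definition eigenvals :: "real set" where
  "eigenvals = {s. \<exists>v. eigvec s v \<and> (\<exists>x\<in>V. v x \<noteq> 0)}"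

definition papp :: "real poly \<Rightarrow> ('v \<Rightarrow> real) \<Rightarrow> 'v \<Rightarrow> real" where
  "papp p v = (\<lambda>x. \<Sum>i\<le>degree p. coeff p i * (app ^^ i) v x)"

lemma app_cong: "(\<And>x. x \<in> V \<Longrightarrow> u x = v x) \<Longrightarrow> app u = app v"
  unfolding app_def by (auto intro!: ext sum.cong)

lemma shift_cong: "(\<And>x. x \<in> V \<Longrightarrow> u x = v x) \<Longrightarrow> x \<in> V \<Longrightarrow> shift s u x = shift s v x"
  unfolding shift_def using app_cong[of u v] by simp

lemma ip_cong: "(\<And>x. x \<in> V \<Longrightarrow> u x = u' x) \<Longrightarrow> (\<And>x. x \<in> V \<Longrightarrow> v x = v' x) \<Longrightarrow> ip u v = ip u' v'"
  unfolding ip_def by (auto intro!: sum.cong)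

lemma app_add: "app (\<lambda>x. u x + v x) = (\<lambda>x. app u x + app v x)"
  unfolding app_def by (simp add: algebra_simps sum.distrib)

lemma app_diff: "app (\<lambda>x. u x - v x) = (\<lambda>x. app u x - app v x)"
  unfolding app_def by (simp add: algebra_simps sum_subtractf)

lemma app_scale: "app (\<lambda>x. c * u x) = (\<lambda>x. c * app u x)"
  unfolding app_def by (simp add: algebra_simps sum_distrib_left)

lemma app_sum: "app (\<lambda>x. \<Sum>i\<in>I. u i x) = (\<lambda>x. \<Sum>i\<in>I. app (u i) x)"
  unfolding app_def sum_distrib_left by (rule ext, rule sum.swap)

lemma app_zero: "app (\<lambda>x. 0) = (\<lambda>x. 0)"
  unfolding app_def by simp

lemma ip_commute: "ip u v = ip v u"
  unfolding ip_def by (simp add: mult.commute)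

lemma ip_add: "ip (\<lambda>x. u x + v x) w = ip u w + ip v w" "ip w (\<lambda>x. u x + v x) = ip w u + ip w v"
  unfolding ip_def by (simp_all add: algebra_simps sum.distrib)

lemma ip_diff: "ip (\<lambda>x. u x - v x) w = ip u w - ip v w" "ip w (\<lambda>x. u x - v x) = ip w u - ip w v"
  unfolding ip_def by (simp_all add: algebra_simps sum_subtractf)

lemma ip_scale: "ip (\<lambda>x. c * u x) w = c * ip u w" "ip w (\<lambda>x. c * u x) = c * ip w u"
  unfolding ip_def by (simp_all add: algebra_simps sum_distrib_left)

lemma ip_sum: "ip (\<lambda>x. \<Sum>i\<in>I. u i x) w = (\<Sum>i\<in>I. ip (u i) w)"
  unfolding ip_def sum_distrib_right by (rule sum.swap)

lemma ip_nonneg: "ip u u \<ge> 0"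
  unfolding ip_def by (simp add: sum_nonneg)

lemma ip_self_eq_0_iff: "ip u u = 0 \<longleftrightarrow> (\<forall>x\<in>V. u x = 0)"
  unfolding ip_def by (subst sum_nonneg_eq_0_iff) auto

lemma ip_app: "ip (app u) v = ip u (app v)"
proof -
  have "ip (app u) v = (\<Sum>x\<in>V. \<Sum>y\<in>V. a x y * u y * v x)"
    unfolding ip_def app_def by (simp add: sum_distrib_right)
  also have "\<dots> = (\<Sum>y\<in>V. \<Sum>x\<in>V. a x y * u y * v x)" by (rule sum.swap)
  also have "\<dots> = ip u (app v)"
    unfolding ip_def app_def sum_distrib_left
    by (intro sum.cong refl) (simp add: sym)
  finally show ?thesis .
qed

lemma ip_shift: "ip (shift s u) v = ip u (shift s v)"
  unfolding shift_def by (simp add: ip_diff ip_scale ip_app)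

text \<open>By symmetry |(A - s) v|^2 is the inner product of v with (A - s)^2 v. Generalised
  eigenvectors of a symmetric matrix are therefore eigenvectors.\<close>

lemma shift_eq_0D:
  assumes "\<forall>x\<in>V. shift s (shift s v) x = 0"
  shows "\<forall>x\<in>V. shift s v x = 0"
proof -
  have "ip (shift s v) (shift s v) = ip v (shift s (shift s v))"
    by (simp add: ip_shift)
  also have "\<dots> = 0" using assms by (simp add: ip_def)
  finally show ?thesis by (simp add: ip_self_eq_0_iff)
qed

lemma eigvec_iff_shift: "eigvec s v \<longleftrightarrow> (\<forall>x\<in>V. shift s v x = 0)"
  by (simp add: eigvec_def shift_def)

lemma papp_0: "papp 0 v = (\<lambda>x. 0)"
  by (simp add: papp_def)

lemma papp_extend: "degree p \<le> n \<Longrightarrow> papp p v x = (\<Sum>i\<le>n. coeff p i * (app ^^ i) v x)"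
  unfolding papp_def by (rule sum.mono_neutral_left) (auto simp: coeff_eq_0)

lemma papp_pCons: "papp (pCons c p) v = (\<lambda>x. c * v x + app (papp p v) x)"
proof
  fix x
  have "papp (pCons c p) v x = (\<Sum>i\<le>Suc (degree p). coeff (pCons c p) i * (app ^^ i) v x)"
    by (rule papp_extend) (rule degree_pCons_le)
  also have "\<dots> = c * v x + (\<Sum>i\<le>degree p. coeff p i * app ((app ^^ i) v) x)"
    by (subst sum.atMost_Suc_shift) simp
  also have "(\<Sum>i\<le>degree p. coeff p i * app ((app ^^ i) v) x) = app (papp p v) x"
    unfolding papp_def by (simp add: app_sum app_scale)
  finally show "papp (pCons c p) v x = c * v x + app (papp p v) x" .
qed

lemma papp_add: "papp (p + q) v x = papp p v x + papp q v x"
proof -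
  define n where "n = max (degree p) (degree q)"
  have "degree (p + q) \<le> n" "degree p \<le> n" "degree q \<le> n"
    using degree_add_le_max[of p q] by (auto simp: n_def)
  then show ?thesis by (simp add: papp_extend algebra_simps sum.distrib)
qed

lemma papp_smult: "papp (Polynomial.smult c p) v x = c * papp p v x"
proof -
  have "papp (Polynomial.smult c p) v x = (\<Sum>i\<le>degree p. coeff (Polynomial.smult c p) i * (app ^^ i) v x)"
    by (rule papp_extend) (rule degree_smult_le)
  then show ?thesis by (simp add: papp_def sum_distrib_left mult.assoc)
qed

lemma papp_mult: "papp (p * q) v = papp p (papp q v)"
proof (induction p)
  case 0
  show ?case by (rule ext) (simp add: papp_0)
next
  case (pCons c p)
  show ?case
    by (rule ext) (simp add: papp_add papp_smult papp_pCons pCons.IH)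
qed

lemma papp_const: "papp [:c:] v x = c * v x"
  by (simp add: papp_def)

lemma papp_linear_factor: "papp [:- s, 1:] v = shift s v"
  by (simp add: papp_pCons papp_0 app_zero shift_def)

text \<open>The \<open>|V| + 1\<close> vectors \<open>v, A v, A\<^sup>2 v, \<dots>\<close> are linearly dependent.\<close>

lemma ex_annihilating_poly:
  obtains p where "p \<noteq> 0" "\<forall>x\<in>V. papp p v x = 0"
proof -
  obtain xs where xs: "distinct xs" "set xs = V"
    using finite_distinct_list[OF finite_V] by blast
  define n where "n = length xs"
  \<comment> \<open>The columns are the iterates of \<open>v\<close>. There is one more column than
    there are vertices, and a zero row in position \<open>n\<close> makes the matrix square; it is
    also the reason why the determinant vanishes.\<close>
  define M where "M = mat (Suc n) (Suc n) (\<lambda>(i, j). if i < n then (app ^^ j) v (xs ! i) else 0)"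
  have M: "M \<in> carrier_mat (Suc n) (Suc n)" by (simp add: M_def)
  have "transpose_mat M *\<^sub>v unit_vec (Suc n) n = 0\<^sub>v (Suc n)"
    using M by (intro eq_vecI) (auto simp: M_def)
  moreover have "unit_vec (Suc n) n \<noteq> (0\<^sub>v (Suc n) :: real vec)"
    by (rule unit_vec_nonzero) simp
  ultimately have "det (transpose_mat M) = 0"
    using det_0_iff_vec_prod_zero[of "transpose_mat M" "Suc n"] M
    by (metis transpose_carrier_mat unit_vec_carrier)
  then have "det M = 0" using det_transpose[OF M] by simp
  then obtain c where c: "c \<in> carrier_vec (Suc n)" "c \<noteq> 0\<^sub>v (Suc n)" "M *\<^sub>v c = 0\<^sub>v (Suc n)"
    using det_0_iff_vec_prod_zero[OF M] by blast
  define p where "p = Poly (list_of_vec c)"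
  have coeff_p: "coeff p i = (if i \<le> n then c $ i else 0)" for i
    using c(1) by (auto simp: p_def coeff_Poly nth_default_def list_of_vec_index)
  have "p \<noteq> 0"
  proof
    assume "p = 0"
    then have "c $ i = 0" if "i \<le> n" for i using coeff_p[of i] that by simp
    then have "c = 0\<^sub>v (Suc n)" using c(1) by (intro eq_vecI) auto
    then show False using c(2) by simp
  qed
  moreover have "papp p v x = 0" if x: "x \<in> V" for x
  proof -
    obtain i where i: "i < n" "x = xs ! i"
      using x unfolding xs(2)[symmetric] n_def in_set_conv_nth by blast
    have "degree p \<le> n" using coeff_p by (intro degree_le) auto
    then have "papp p v x = (\<Sum>j\<le>n. c $ j * (app ^^ j) v x)"
      by (simp add: papp_extend coeff_p)
    also have "\<dots> = (\<Sum>j = 0..<Suc n. (app ^^ j) v x * c $ j)"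
      by (rule sum.cong) (auto simp: mult.commute)
    also have "\<dots> = (M *\<^sub>v c) $ i"
      using i c(1) by (simp add: M_def scalar_prod_def)
    also have "\<dots> = 0" using c(3) i by simp
    finally show ?thesis .
  qed
  ultimately show thesis using that by blast
qed

end

text \<open>Take a complex root z. If it is not real, the remainder of p modulo (X - Re z)^2 + (Im
  z)^2 is a real polynomial of degree at most 1 vanishing at z, hence zero.\<close>

lemma real_poly_linear_or_quadratic_factor:
  fixes p :: "real poly"
  assumes "degree p > 0"
  shows "(\<exists>s. [:- s, 1:] dvd p) \<or> (\<exists>b c. c > 0 \<and> [:b\<^sup>2 + c, - 2 * b, 1:] dvd p)"
proof -
  interpret of_real_poly_hom: map_poly_idom_hom "of_real :: real \<Rightarrow> complex" ..
  have deg: "degree (map_poly complex_of_real p) = degree p"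
    by (rule degree_map_poly) auto
  then have "\<not> constant (poly (map_poly complex_of_real p))"
    using assms by (simp add: constant_degree)
  then obtain z where z: "poly (map_poly complex_of_real p) z = 0"
    using fundamental_theorem_of_algebra by blast
  show ?thesis
  proof (cases "Im z = 0")
    case True
    then obtain s where "z = of_real s" by (metis complex_is_Real_iff Reals_cases)
    then have "poly p s = 0" using z by simp
    then show ?thesis by (auto simp: poly_eq_0_iff_dvd)
  next
    case False
    define q where "q = [:(Re z)\<^sup>2 + (Im z)\<^sup>2, - 2 * Re z, 1:]"
    define r where "r = p mod q"
    have dq: "degree q = 2" by (simp add: q_def)
    have "degree r < 2 \<or> r = 0" using degree_mod_less[of q p] dq unfolding r_def by fastforce
    then have "degree r \<le> 1" by auto
    then have r: "r = [:coeff r 0, coeff r 1:]"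
      by (intro poly_eqI) (auto simp: coeff_pCons coeff_eq_0 split: nat.split)
    define u w where "u = coeff r 0" and "w = coeff r 1"
    note r = r[folded u_def w_def]
    have "p = q * (p div q) + r" by (simp add: r_def)
    then have "map_poly complex_of_real p
        = map_poly complex_of_real q * map_poly complex_of_real (p div q) + map_poly complex_of_real r"
      by (metis of_real_poly_hom.hom_add of_real_poly_hom.hom_mult)
    moreover have "poly (map_poly complex_of_real q) z = 0"
      by (simp add: q_def map_poly_pCons complex_eq_iff power2_eq_square algebra_simps)
    ultimately have "poly (map_poly complex_of_real r) z = 0" using z by simp
    then have "complex_of_real u + z * complex_of_real w = 0"
      by (subst (asm) r) (simp add: of_real_hom.map_poly_pCons_hom)
    then have "u + w * Re z = 0 \<and> w * Im z = 0"
      by (simp add: complex_eq_iff mult.commute)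
    then have "r = 0" using False r by auto
    then have "q dvd p" by (simp add: r_def dvd_eq_mod_eq_0)
    then show ?thesis using False unfolding q_def
      by (intro disjI2 exI[of _ "Re z"] exI[of _ "(Im z)\<^sup>2"]) auto
  qed
qed

section \<open>The spectral theorem\<close>

context symmetric_matrix
begin

lemma eigvec_scale: "eigvec s v \<Longrightarrow> eigvec s (\<lambda>x. c * v x)"
  by (simp add: eigvec_def app_scale)

text \<open>Induction on the degree, splitting off a real factor of p. A linear factor costs at most
  one further eigenvalue; a quadratic factor without real roots is positive definite at a symmetric
  matrix and can be cancelled.\<close>

lemma decomposition_if_annihilated:
  assumes "p \<noteq> 0" "\<forall>x\<in>V. papp p v x = 0"
  shows "\<exists>T u. finite T \<and> (\<forall>t\<in>T. eigvec t (u t)) \<and> (\<forall>x\<in>V. v x = (\<Sum>t\<in>T. u t x))"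
  using assms
proof (induction "degree p" arbitrary: p v rule: less_induct)
  case less
  show ?case
  proof (cases "degree p = 0")
    case True
    then obtain c where c: "p = [:c:]" using degree_eq_zeroE by blast
    then have "\<forall>x\<in>V. v x = 0" using less.prems by (simp add: papp_const)
    then show ?thesis by (intro exI[of _ "{}"]) auto
  next
    case False
    then consider (linear) s where "[:- s, 1:] dvd p"
      | (quadratic) b c where "c > 0" "[:b\<^sup>2 + c, - 2 * b, 1:] dvd p"
      using real_poly_linear_or_quadratic_factor[of p] by auto
    then show ?thesis
    proof cases
      case linear
      then obtain g where g: "p = [:- s, 1:] * g" by (rule dvdE)
      then have "g \<noteq> 0" using less.prems by auto
      then have deg: "degree g < degree p" unfolding g by (subst degree_mult_eq) auto
      have "papp g (shift s v) = papp p v"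
        unfolding g by (metis mult.commute papp_linear_factor papp_mult)
      then obtain T u where T: "finite T" "\<forall>t\<in>T. eigvec t (u t)"
        and sum_u: "\<forall>x\<in>V. shift s v x = (\<Sum>t\<in>T. u t x)"
        using less.hyps[OF deg \<open>g \<noteq> 0\<close>, of "shift s v"] less.prems by auto
      \<comment> \<open>A - s multiplies a t-eigenvector by t - s, so for t \<noteq> s these are
        preimages of the components of (A - s) v. What remains of v after subtracting them is
        \<open>v'\<close>, which A - s sends to the s-component; hence (A - s)^2 annihilates
        \<open>v'\<close>.\<close>
      define u' where "u' t = (\<lambda>x. 1 / (t - s) * u t x)" for t
      define v' where "v' = (\<lambda>x. v x - (\<Sum>t\<in>T - {s}. u' t x))"
      have eig_u': "eigvec t (u' t)" if "t \<in> T" for t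
        using T(2) that unfolding u'_def by (intro eigvec_scale) auto
      have shift_v': "shift s v' x = (if s \<in> T then u s x else 0)" if x: "x \<in> V" for x
      proof -
        have "shift s v' x = shift s v x - (\<Sum>t\<in>T - {s}. app (u' t) x - s * u' t x)"
          unfolding shift_def v'_def app_diff app_sum
          by (simp add: sum_subtractf sum_distrib_left algebra_simps)
        also have "(\<Sum>t\<in>T - {s}. app (u' t) x - s * u' t x) = (\<Sum>t\<in>T - {s}. u t x)"
        proof (rule sum.cong[OF refl])
          fix t assume t: "t \<in> T - {s}"
          then have "app (u' t) x - s * u' t x = (t - s) * u' t x"
            using x eig_u'[of t] by (simp add: eigvec_def algebra_simps)
          then show "app (u' t) x - s * u' t x = u t x" using t by (simp add: u'_def)
        qed
        also have "shift s v x = (\<Sum>t\<in>T. u t x)" using sum_u x by blast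
        finally show ?thesis using T(1) by (auto simp: sum_diff1)
      qed
      have "\<forall>x\<in>V. shift s (shift s v') x = 0"
      proof
        fix x assume x: "x \<in> V"
        have "shift s (shift s v') x = shift s (\<lambda>x. if s \<in> T then u s x else 0) x"
          using shift_v' x by (intro shift_cong) auto
        also have "\<dots> = 0" using T(2) x by (auto simp: shift_def app_zero eigvec_def)
        finally show "shift s (shift s v') x = 0" .
      qed
      then have "eigvec s v'" by (simp add: eigvec_iff_shift shift_eq_0D)
      then show ?thesis
        using T eig_u'
        by (intro exI[of _ "insert s T"] exI[of _ "\<lambda>t. if t = s then v' else u' t"])
          (auto simp: v'_def sum.insert_remove intro!: sum.cong)
    next
      case quadratic
      then obtain g where g: "p = [:b\<^sup>2 + c, - 2 * b, 1:] * g" by (auto elim: dvdE)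
      then have "g \<noteq> 0" using less.prems by auto
      then have deg: "degree g < degree p" unfolding g by (subst degree_mult_eq) auto
      \<comment> \<open>Completing the square turns the quadratic factor into (A - b)^2 + c. Pairing
        with \<open>w\<close> gives |(A - b) w|^2 + c |w|^2 = 0 with c > 0, so \<open>w\<close>
        vanishes on V and \<open>g\<close> alone annihilates \<open>v\<close>.\<close>
      define w where "w = papp g v"
      have "papp p v = papp [:b\<^sup>2 + c, - 2 * b, 1:] w"
        unfolding g w_def papp_mult ..
      also have "\<dots> = (\<lambda>x. shift b (shift b w) x + c * w x)"
        using app_scale[of 2 w]
        by (intro ext) (simp add: papp_pCons papp_0 shift_def app_diff app_add app_scale app_zero
            power2_eq_square algebra_simps)
      finally have "\<forall>x\<in>V. shift b (shift b w) x + c * w x = 0" using less.prems by simp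
      then have "ip w (\<lambda>x. shift b (shift b w) x + c * w x) = 0" by (simp add: ip_def)
      then have "ip (shift b w) (shift b w) + c * ip w w = 0"
        by (simp add: ip_add ip_scale ip_shift)
      moreover have "c * ip w w \<ge> 0" using quadratic ip_nonneg by simp
      ultimately have "c * ip w w = 0"
        using ip_nonneg[of "shift b w"] by linarith
      then have "\<forall>x\<in>V. w x = 0" using quadratic by (simp add: ip_self_eq_0_iff)
      then show ?thesis using less.hyps[OF deg \<open>g \<noteq> 0\<close>] by (simp add: w_def)
    qed
  qed
qed

text \<open>The components are indexed by all of \<open>eigenvals\<close>, with 0 for those that do
  not occur, so that one index set serves every vector. An index outside \<open>eigenvals\<close>
  can only carry a vector that is zero on V.\<close>

theorem spectral_decomposition:
  assumes "finite eigenvals"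
  obtains u where "\<And>t. eigvec t (u t)" "\<And>x. x \<in> V \<Longrightarrow> v x = (\<Sum>t\<in>eigenvals. u t x)"
proof -
  obtain p where "p \<noteq> 0" "\<forall>x\<in>V. papp p v x = 0" using ex_annihilating_poly .
  then obtain T u where T: "finite T" "\<forall>t\<in>T. eigvec t (u t)"
    "\<forall>x\<in>V. v x = (\<Sum>t\<in>T. u t x)"
    using decomposition_if_annihilated by metis
  show thesis
  proof (rule that[of "\<lambda>t. if t \<in> T then u t else (\<lambda>x. 0)"])
    show "eigvec t (if t \<in> T then u t else (\<lambda>x. 0))" for t
      using T(2) by (auto simp: eigvec_def app_zero)
    fix x assume x: "x \<in> V"
    have "v x = (\<Sum>t\<in>T. u t x)" using T(3) x by blast
    also have "\<dots> = (\<Sum>t\<in>T \<inter> eigenvals. u t x)"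
      using T(1,2) x by (intro sum.mono_neutral_right) (auto simp: eigenvals_def)
    also have "\<dots> = (\<Sum>t\<in>eigenvals. (if t \<in> T then u t else (\<lambda>x. 0)) x)"
      using assms by (intro sum.mono_neutral_cong_left) auto
    finally show "v x = (\<Sum>t\<in>eigenvals. (if t \<in> T then u t else (\<lambda>x. 0)) x)" .
  qed
qed

section \<open>Products of the operators A - s\<close>

definition shifts :: "real list \<Rightarrow> ('v \<Rightarrow> real) \<Rightarrow> 'v \<Rightarrow> real" where
  "shifts ss = foldr shift ss"

lemma shifts_simps [simp]:
  "shifts [] v = v" "shifts (s # ss) v = shift s (shifts ss v)"
  "shifts (ss @ ts) v = shifts ss (shifts ts v)"
  by (simp_all add: shifts_def)

lemma shifts_cong: "(\<And>x. x \<in> V \<Longrightarrow> u x = v x) \<Longrightarrow> x \<in> V \<Longrightarrow> shifts ss u x = shifts ss v x"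
  by (induction ss arbitrary: x) (auto intro: shift_cong)

lemma shift_add: "shift s (\<lambda>x. u x + v x) = (\<lambda>x. shift s u x + shift s v x)"
  by (simp add: shift_def app_add algebra_simps)

lemma shift_diff: "shift s (\<lambda>x. u x - v x) = (\<lambda>x. shift s u x - shift s v x)"
  by (simp add: shift_def app_diff algebra_simps)

lemma shift_scale: "shift s (\<lambda>x. c * v x) = (\<lambda>x. c * shift s v x)"
  by (simp add: shift_def app_scale algebra_simps)

lemma shift_sum: "shift s (\<lambda>x. \<Sum>i\<in>I. u i x) = (\<lambda>x. \<Sum>i\<in>I. shift s (u i) x)"
  by (simp add: shift_def app_sum sum_distrib_left sum_subtractf)

lemma shift_commute: "shift s (shift t v) = shift t (shift s v)"
  by (simp add: shift_def app_diff app_scale algebra_simps)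

lemma shifts_scale: "shifts ss (\<lambda>x. c * v x) = (\<lambda>x. c * shifts ss v x)"
  by (induction ss) (auto simp: shift_scale)

lemma shifts_sum: "shifts ss (\<lambda>x. \<Sum>i\<in>I. u i x) = (\<lambda>x. \<Sum>i\<in>I. shifts ss (u i) x)"
  by (induction ss) (auto simp: shift_sum)

lemma shift_shifts_commute: "shift s (shifts ss v) = shifts ss (shift s v)"
  by (induction ss) (auto simp: shift_commute[of s])

lemma ip_shifts: "ip (shifts ss u) v = ip u (shifts ss v)"
  by (induction ss arbitrary: v) (simp_all add: ip_shift flip: shift_shifts_commute)

lemma shifts_eigvec:
  assumes "eigvec t v" "x \<in> V"
  shows "shifts ss v x = (\<Prod>s\<leftarrow>ss. t - s) * v x"
  using assms(2)
proof (induction ss arbitrary: x)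
  case (Cons s ss)
  have "shifts (s # ss) v x = shift s (\<lambda>x. (\<Prod>s\<leftarrow>ss. t - s) * v x) x"
    using Cons by (auto intro: shift_cong)
  also have "\<dots> = (\<Prod>s\<leftarrow>ss. t - s) * shift s v x" by (simp add: shift_scale)
  also have "shift s v x = (t - s) * v x"
    using assms(1) Cons.prems by (simp add: shift_def eigvec_def algebra_simps)
  finally show ?case by (simp add: algebra_simps)
qed auto

text \<open>Both terms on the right are powers of A applied to \<open>v\<close>. A statement about
  all powers of A thus passes to products of factors A - s one factor at a time, which is how walk
  counts reach the eigenprojections.\<close>

lemma app_funpow_shift:
  "(app ^^ l) (shift s v) = (\<lambda>x. (app ^^ Suc l) v x - s * (app ^^ l) v x)"
proof (induction l)
  case (Suc l)
  have "(app ^^ Suc l) (shift s v) = app ((app ^^ l) (shift s v))" by simp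
  also have "\<dots> = (\<lambda>x. (app ^^ Suc (Suc l)) v x - s * (app ^^ Suc l) v x)"
    unfolding Suc by (simp add: app_diff app_scale)
  finally show ?case .
qed (simp add: shift_def)

text \<open>The minimal polynomial of a symmetric matrix has the eigenvalues as its simple roots.\<close>

lemma shifts_eigenvals_eq_0:
  assumes "finite eigenvals" "eigenvals \<subseteq> set ss" "x \<in> V"
  shows "shifts ss v x = 0"
proof -
  obtain u where u: "\<And>t. eigvec t (u t)" "\<And>x. x \<in> V \<Longrightarrow> v x = (\<Sum>t\<in>eigenvals. u t x)"
    using spectral_decomposition[OF assms(1)] by metis
  have "shifts ss v x = (\<Sum>t\<in>eigenvals. shifts ss (u t) x)"
    using shifts_cong[OF u(2) assms(3)] by (simp add: shifts_sum)
  also have "\<dots> = (\<Sum>t\<in>eigenvals. 0)"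
    using assms(2) by (intro sum.cong refl)
      (auto simp: shifts_eigvec[OF u(1) assms(3)] prod_list_zero_iff)
  finally show ?thesis by simp
qed

lemma eigvec_orthogonal:
  assumes "eigvec s u" "eigvec t v" "s \<noteq> t"
  shows "ip u v = 0"
proof -
  have "s * ip u v = ip (app u) v"
    using assms(1) by (auto simp: ip_def eigvec_def sum_distrib_left intro!: sum.cong)
  also have "\<dots> = t * ip u v"
    unfolding ip_app using assms(2) by (auto simp: ip_def eigvec_def sum_distrib_left intro!: sum.cong)
  finally show ?thesis using assms(3) by simp
qed

text \<open>Orthogonality of the eigenspaces splits the norm and the quadratic form into sums with
  the same nonnegative weights, so the Rayleigh quotient of a test vector is a weighted mean of
  eigenvalues. The last clause computes a weight by pairing the component with v itself.\<close>

lemma spectral_decomposition_orthogonal: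
  assumes "finite eigenvals"
  obtains u where "\<And>t. eigvec t (u t)"
    "ip v v = (\<Sum>t\<in>eigenvals. ip (u t) (u t))"
    "ip v (app v) = (\<Sum>t\<in>eigenvals. t * ip (u t) (u t))"
    "\<And>t. t \<in> eigenvals \<Longrightarrow> ip v (u t) = ip (u t) (u t)"
proof -
  obtain u where u: "\<And>t. eigvec t (u t)" "\<And>x. x \<in> V \<Longrightarrow> v x = (\<Sum>t\<in>eigenvals. u t x)"
    using spectral_decomposition[OF assms(1)] by metis
  have proj: "ip v (u t) = ip (u t) (u t)" if t: "t \<in> eigenvals" for t
  proof -
    have "ip v (u t) = ip (\<lambda>x. \<Sum>s\<in>eigenvals. u s x) (u t)"
      using u(2) by (intro ip_cong) auto
    also have "\<dots> = (\<Sum>s\<in>eigenvals. if s = t then ip (u t) (u t) else 0)"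
      unfolding ip_sum using eigvec_orthogonal[OF u(1) u(1)] by (intro sum.cong) auto
    also have "\<dots> = ip (u t) (u t)" using t assms by simp
    finally show ?thesis .
  qed
  have "ip v v = ip (\<lambda>x. \<Sum>s\<in>eigenvals. u s x) v"
    using u(2) by (intro ip_cong) auto
  also have "\<dots> = (\<Sum>t\<in>eigenvals. ip (u t) (u t))"
    unfolding ip_sum by (intro sum.cong refl) (simp add: ip_commute[of _ v] proj)
  finally have 1: "ip v v = \<dots>" .
  have "ip v (app v) = ip (\<lambda>x. \<Sum>s\<in>eigenvals. u s x) (app v)"
    using u(2) by (intro ip_cong) auto
  also have "\<dots> = (\<Sum>t\<in>eigenvals. t * ip (u t) (u t))"
    unfolding ip_sum
  proof (intro sum.cong refl)
    fix t assume t: "t \<in> eigenvals"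
    have "ip (u t) (app v) = ip (\<lambda>x. t * u t x) v"
      unfolding ip_app[symmetric] using u(1)[of t] by (intro ip_cong) (auto simp: eigvec_def)
    then show "ip (u t) (app v) = t * ip (u t) (u t)"
      using proj[OF t] by (simp add: ip_scale ip_commute[of _ v])
  qed
  finally have 2: "ip v (app v) = \<dots>" .
  show thesis using that[OF u(1) 1 2 proj] by blast
qed

end

section \<open>The spectrum of a graph\<close>

text \<open>The enumeration of the vertices carries vectors to functions on the vertex set. The
  matrix \<open>a\<close> is prescribed only on the vertices of H, so that the adjacency of a whole
  graph can be used for its local graphs.\<close>

lemma graph_spectrum_eq_eigenvals:
  assumes "symmetric_matrix (verts H) a"
    and a: "\<And>x y. x \<in> verts H \<Longrightarrow> y \<in> verts H \<Longrightarrow> a x y = of_bool (x \<rightarrow>\<^bsub>H\<^esub> y)"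
  shows "graph_spectrum H = symmetric_matrix.eigenvals (verts H) a"
    and "finite (symmetric_matrix.eigenvals (verts H) a)"
proof -
  interpret symmetric_matrix "verts H" a by fact
  define xs where "xs = vertex_list H"
  define n where "n = length xs"
  define A where "A = adjacency_matrix H"
  have xs: "distinct xs \<and> set xs = verts H"
    unfolding xs_def vertex_list_def using finite_distinct_list[OF finite_V]
    by (metis (mono_tags, lifting) someI_ex)
  then have bij: "bij_betw ((!) xs) {..<n} (verts H)"
    by (intro bij_betw_nth) (auto simp: n_def)
  have nth: "xs ! i \<in> verts H" if "i < n" for i
    using bij that by (auto simp: bij_betw_def)
  have A: "A \<in> carrier_mat n n"
    by (simp add: A_def adjacency_matrix_def Let_def n_def xs_def)
  have mult: "(A *\<^sub>v w) $ i = app v (xs ! i)"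
    if w: "w \<in> carrier_vec n" "\<And>j. j < n \<Longrightarrow> w $ j = v (xs ! j)" and i: "i < n" for v w i
  proof -
    have "(A *\<^sub>v w) $ i = (\<Sum>j<n. A $$ (i, j) * w $ j)"
      using i w(1) A by (auto simp: scalar_prod_def lessThan_atLeast0)
    also have "\<dots> = (\<Sum>j<n. of_bool (xs ! i \<rightarrow>\<^bsub>H\<^esub> xs ! j) * w $ j)"
    proof (intro sum.cong refl)
      fix j assume "j \<in> {..<n}"
      then have "A $$ (i, j) = of_bool (xs ! i \<rightarrow>\<^bsub>H\<^esub> xs ! j)"
        using i by (simp add: A_def adjacency_matrix_def Let_def n_def xs_def)
      then show "A $$ (i, j) * w $ j = of_bool (xs ! i \<rightarrow>\<^bsub>H\<^esub> xs ! j) * w $ j" by simp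
    qed
    also have "\<dots> = (\<Sum>j<n. a (xs ! i) (xs ! j) * v (xs ! j))"
      using i w(2) nth by (intro sum.cong) (auto simp: a)
    also have "\<dots> = app v (xs ! i)"
      unfolding app_def by (rule sum.reindex_bij_betw[OF bij])
    finally show ?thesis .
  qed
  have "s \<in> spectrum A \<longleftrightarrow> s \<in> eigenvals" for s
  proof
    assume "s \<in> spectrum A"
    then obtain w where w: "w \<in> carrier_vec n" "w \<noteq> 0\<^sub>v n" "A *\<^sub>v w = s \<cdot>\<^sub>v w"
      using A by (auto simp: spectrum_def eigenvalue_def eigenvector_def)
    define v where "v x = w $ the_inv_into {..<n} ((!) xs) x" for x
    have v: "w $ j = v (xs ! j)" if "j < n" for j
      using that bij by (simp add: v_def the_inv_into_f_f bij_betw_def)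
    have "app v x = s * v x" if "x \<in> verts H" for x
    proof -
      obtain i where i: "i < n" "x = xs ! i" using \<open>x \<in> verts H\<close> bij by (auto simp: bij_betw_def)
      show ?thesis using mult[of w v i, OF w(1) v i(1)] w i v by simp
    qed
    moreover obtain i where "i < n" "w $ i \<noteq> 0"
      using w(1,2) by (metis carrier_vecD eq_vecI index_zero_vec(1) index_zero_vec(2))
    then have "v (xs ! i) \<noteq> 0" "xs ! i \<in> verts H" using v nth by auto
    ultimately show "s \<in> eigenvals" unfolding eigenvals_def eigvec_def by blast
  next
    assume "s \<in> eigenvals"
    then obtain v x where v: "eigvec s v" "x \<in> verts H" "v x \<noteq> 0"
      by (auto simp: eigenvals_def)
    define w where "w = vec n (\<lambda>i. v (xs ! i))"
    have w: "w \<in> carrier_vec n" by (simp add: w_def)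
    have "A *\<^sub>v w = s \<cdot>\<^sub>v w"
    proof (intro eq_vecI)
      fix i assume i: "i < dim_vec (s \<cdot>\<^sub>v w)"
      then have "i < n" by (simp add: w_def)
      then show "(A *\<^sub>v w) $ i = (s \<cdot>\<^sub>v w) $ i"
        using mult[of w v i, OF w] v(1) nth by (simp add: w_def eigvec_def)
    qed (use A w in auto)
    moreover obtain i where i: "i < n" "x = xs ! i" using v(2) bij by (auto simp: bij_betw_def)
    then have "w $ i \<noteq> 0" using v by (simp add: w_def)
    then have "w \<noteq> 0\<^sub>v n" using i by auto
    ultimately show "s \<in> spectrum A"
      using A w by (auto simp: spectrum_def eigenvalue_def eigenvector_def)
  qed
  then show "graph_spectrum H = eigenvals" by (auto simp: graph_spectrum_def A_def)
  then show "finite eigenvals" using card_finite_spectrum[OF A] by (simp add: graph_spectrum_def A_def)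
qed

section \<open>Regular zero-one matrices with bounded forms\<close>

locale regular_matrix = symmetric_matrix V a for V :: "'v set" and a +
  fixes r :: real
  assumes zero_one: "x \<in> V \<Longrightarrow> y \<in> V \<Longrightarrow> a x y = 0 \<or> a x y = 1"
    and row_sum: "x \<in> V \<Longrightarrow> (\<Sum>y\<in>V. a x y) = r"
begin

definition sum_zero :: "('v \<Rightarrow> real) \<Rightarrow> bool" where
  "sum_zero w \<longleftrightarrow> (\<Sum>x\<in>V. w x) = 0"

lemma col_sum: "y \<in> V \<Longrightarrow> (\<Sum>x\<in>V. a x y) = r"
  using row_sum[of y] by (simp add: sym cong: sum.cong)

lemma sum_app: "(\<Sum>x\<in>V. app v x) = r * (\<Sum>x\<in>V. v x)"
proof -
  have "(\<Sum>x\<in>V. app v x) = (\<Sum>y\<in>V. (\<Sum>x\<in>V. a x y) * v y)"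
    unfolding app_def sum_distrib_right by (rule sum.swap)
  then show ?thesis by (simp add: col_sum sum_distrib_left)
qed

lemma sum_zero_shift: "sum_zero w \<Longrightarrow> sum_zero (shift s w)"
  by (simp add: sum_zero_def shift_def sum_subtractf sum_app flip: sum_distrib_left)

lemma shift_const: "x \<in> V \<Longrightarrow> shift s (\<lambda>_. c) x = (r - s) * c"
  by (simp add: shift_def app_def row_sum left_diff_distrib flip: sum_distrib_right)

text \<open>For \<sigma> = 1 this is the quadratic form of the Laplacian, for \<sigma> = -1 that of
  the signless Laplacian, with every edge counted twice. Their nonnegativity bounds the eigenvalues
  by r from both sides.\<close>

lemma sum_squares_edges:
  assumes "\<sigma>\<^sup>2 = 1"
  shows "(\<Sum>x\<in>V. \<Sum>y\<in>V. a x y * (v x - \<sigma> * v y)\<^sup>2) = 2 * (r * ip v v - \<sigma> * ip v (app v))"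
proof -
  have "(\<Sum>x\<in>V. \<Sum>y\<in>V. a x y * (v x - \<sigma> * v y)\<^sup>2)
      = (\<Sum>x\<in>V. \<Sum>y\<in>V. a x y * (v x)\<^sup>2) + (\<Sum>x\<in>V. \<Sum>y\<in>V. a x y * (v y)\<^sup>2)
        - 2 * \<sigma> * (\<Sum>x\<in>V. \<Sum>y\<in>V. v x * (a x y * v y))"
    unfolding sum_distrib_left sum.distrib[symmetric] sum_subtractf[symmetric]
    using assms by (intro sum.cong refl) (simp add: power2_diff power_mult_distrib algebra_simps)
  also have "(\<Sum>x\<in>V. \<Sum>y\<in>V. a x y * (v x)\<^sup>2) = r * ip v v"
    unfolding ip_def sum_distrib_left
    by (intro sum.cong refl) (simp add: row_sum power2_eq_square flip: sum_distrib_right)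
  also have "(\<Sum>x\<in>V. \<Sum>y\<in>V. a x y * (v y)\<^sup>2) = r * ip v v"
    unfolding ip_def sum_distrib_left
    by (subst sum.swap, intro sum.cong refl) (simp add: col_sum power2_eq_square flip: sum_distrib_right)
  also have "(\<Sum>x\<in>V. \<Sum>y\<in>V. v x * (a x y * v y)) = ip v (app v)"
    by (simp add: ip_def app_def sum_distrib_left)
  finally show ?thesis by (simp add: algebra_simps)
qed

lemma edge_term_nonneg: "x \<in> V \<Longrightarrow> y \<in> V \<Longrightarrow> a x y * c\<^sup>2 \<ge> 0"
  using zero_one[of x y] by auto

lemma ip_eigvec: "eigvec s v \<Longrightarrow> ip v (app v) = s * ip v v"
  by (auto simp: ip_def eigvec_def sum_distrib_left intro!: sum.cong)

lemma abs_eigenval_le: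
  assumes "s \<in> eigenvals"
  shows "\<bar>s\<bar> \<le> r"
proof -
  obtain v where v: "eigvec s v" "ip v v \<noteq> 0"
    using assms by (auto simp: eigenvals_def ip_self_eq_0_iff)
  have "(r - \<sigma> * s) * ip v v \<ge> 0" if "\<sigma>\<^sup>2 = 1" for \<sigma>
  proof -
    have "0 \<le> (\<Sum>x\<in>V. \<Sum>y\<in>V. a x y * (v x - \<sigma> * v y)\<^sup>2)"
      by (intro sum_nonneg edge_term_nonneg)
    then show ?thesis
      unfolding sum_squares_edges[OF that] using v(1) by (simp add: ip_eigvec algebra_simps)
  qed
  from this[of 1] this[of "-1"] have "r - s \<ge> 0" "r + s \<ge> 0"
    using v(2) ip_nonneg[of v] by (auto simp: zero_le_mult_iff)
  then show ?thesis by linarith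
qed

text \<open>At the eigenvalue \<sigma> r the sum of squares over the edges is zero, hence so is
  every square: eigenvectors for r are constant along edges, those for -r change sign.\<close>

lemma extremal_eigvec_edge:
  assumes "eigvec (\<sigma> * r) v" "\<sigma>\<^sup>2 = 1" "x \<in> V" "y \<in> V" "a x y = 1"
  shows "v x = \<sigma> * v y"
proof -
  have "\<sigma> * (\<sigma> * (r * ip v v)) = \<sigma>\<^sup>2 * (r * ip v v)" by (simp add: power2_eq_square)
  then have "(\<Sum>x\<in>V. \<Sum>y\<in>V. a x y * (v x - \<sigma> * v y)\<^sup>2) = 0"
    unfolding sum_squares_edges[OF assms(2)] ip_eigvec[OF assms(1)] using assms(2)
    by (simp add: mult.assoc)
  then have "\<forall>x\<in>V. (\<Sum>y\<in>V. a x y * (v x - \<sigma> * v y)\<^sup>2) = 0"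
    by (subst (asm) sum_nonneg_eq_0_iff) (auto intro!: sum_nonneg edge_term_nonneg)
  then have "(\<Sum>y\<in>V. a x y * (v x - \<sigma> * v y)\<^sup>2) = 0" using assms(3) by blast
  then have "\<forall>y\<in>V. a x y * (v x - \<sigma> * v y)\<^sup>2 = 0"
    using assms(3) by (subst (asm) sum_nonneg_eq_0_iff) (auto intro!: edge_term_nonneg)
  then show ?thesis using assms(4,5) by auto
qed

lemma app_unit: "z \<in> V \<Longrightarrow> app (\<lambda>x. of_bool (x = z)) y = a y z"
  by (simp add: app_def if_distrib of_bool_def cong: if_cong)

lemma ip_unit: "z \<in> V \<Longrightarrow> ip (\<lambda>x. of_bool (x = z)) w = w z"
  by (simp add: ip_def of_bool_def if_distrib[where f = "\<lambda>t. t * _"] cong: if_cong)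

end

section \<open>Regular matrices whose form is bounded on the vectors with coordinate sum 0\<close>

locale local_matrix = regular_matrix V a r for V :: "'v set" and a r +
  fixes lo hi :: real
  assumes loopless: "x \<in> V \<Longrightarrow> a x x = 0"
    and nonempty: "V \<noteq> {}"
    and lo_less_hi: "lo < hi"
    and lower: "sum_zero w \<Longrightarrow> lo * ip w w \<le> ip w (app w)"
    and upper: "sum_zero w \<Longrightarrow> ip w (app w) \<le> hi * ip w w"
begin

definition R :: "('v \<Rightarrow> real) \<Rightarrow> 'v \<Rightarrow> real" where
  "R w = shift lo (shift hi w)"

text \<open>The orthogonal projection of a unit vector to the vectors with sum 0. Pairing such a
  vector with it evaluates the vector at y, so these projections suffice to detect that a vector of
  sum 0 vanishes.\<close>

definition centred_unit :: "'v \<Rightarrow> 'v \<Rightarrow> real" where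
  "centred_unit y = (\<lambda>x. of_bool (x = y) - 1 / card V)"

lemma sum_zero_R: "sum_zero w \<Longrightarrow> sum_zero (R w)"
  by (simp add: R_def sum_zero_shift)

lemma ip_R: "ip (R u) w = ip u (R w)"
  unfolding R_def by (simp add: ip_shift shift_commute)

lemma sum_zero_centred_unit: "y \<in> V \<Longrightarrow> sum_zero (centred_unit y)"
  using nonempty by (simp add: sum_zero_def centred_unit_def sum_subtractf of_bool_def)

lemma ip_centred_unit: "y \<in> V \<Longrightarrow> sum_zero w \<Longrightarrow> ip (centred_unit y) w = w y"
  unfolding centred_unit_def
  by (simp add: ip_diff ip_unit) (simp add: ip_def sum_zero_def flip: sum_distrib_left sum_divide_distrib)

text \<open>The Cauchy--Schwarz inequality for the positive form \<open>w \<mapsto> w \<bullet> (A - lo) w\<close>, whose norm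
  is at most \<open>hi - lo\<close>.\<close>

lemma ip_R_nonpos:
  assumes w: "sum_zero w"
  shows "ip w (R w) \<le> 0"
proof -
  define z where "z = shift lo w"
  \<comment> \<open>Positivity of the form at \<open>w - c * z\<close> yields 2 c |z|^2 on one side
    and a term quadratic in c on the other. With this c the upper bound reduces the quadratic term
    to c |z|^2, which leaves exactly the required estimate.\<close>
  define c where "c = 1 / (hi - lo)"
  define u where "u = (\<lambda>x. w x - c * z x)"
  have z: "sum_zero z" unfolding z_def using w by (rule sum_zero_shift)
  have "sum_zero u"
    using w z by (simp add: sum_zero_def u_def sum_subtractf flip: sum_distrib_left)
  then have "0 \<le> ip u (shift lo u)"
    using lower[of u] by (simp add: shift_def ip_diff ip_scale)
  also have "shift lo u = (\<lambda>x. z x - c * shift lo z x)"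
    unfolding u_def by (simp add: shift_diff shift_scale z_def)
  also have "ip u \<dots> = ip w z - 2 * c * ip z z + c * (c * ip z (shift lo z))"
    unfolding u_def using ip_shift[of lo w z]
    by (simp add: ip_diff ip_scale algebra_simps flip: z_def)
  finally have "2 * c * ip z z \<le> ip w z + c * (c * ip z (shift lo z))" by simp
  moreover have "c * (c * ip z (shift lo z)) \<le> c * ip z z"
  proof (rule mult_left_mono)
    have "ip z (shift lo z) \<le> (hi - lo) * ip z z"
      using upper[OF z] by (simp add: shift_def ip_diff ip_scale algebra_simps)
    then show "c * ip z (shift lo z) \<le> ip z z" using lo_less_hi by (simp add: c_def field_simps)
  qed (use lo_less_hi in \<open>simp add: c_def\<close>)
  ultimately have "c * ip z z \<le> ip w z" by simp
  then have "ip z z \<le> (hi - lo) * ip w z"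
    using lo_less_hi by (simp add: c_def field_simps)
  moreover have "ip w (R w) = ip z z - (hi - lo) * ip w z"
  proof -
    have "shift hi w = (\<lambda>x. z x - (hi - lo) * w x)"
      by (rule ext) (simp add: z_def shift_def algebra_simps)
    then have "ip z (shift hi w) = ip z z - (hi - lo) * ip z w" by (simp add: ip_diff ip_scale)
    moreover have "ip w (R w) = ip z (shift hi w)"
      unfolding R_def z_def by (simp only: ip_shift)
    ultimately show ?thesis by (simp add: ip_commute[of z w])
  qed
  ultimately show ?thesis by simp
qed

text \<open>The value of the form of \<open>R\<close> at every centred unit vector: r is the
  diagonal entry of A^2, the diagonal of A contributes 0, and the subtracted term is the share of
  the constant vectors, on which \<open>R\<close> acts as (r - lo) (r - hi).\<close>

definition gap :: real where
  "gap = r + lo * hi - (r - lo) * (r - hi) / card V"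

lemma R_unit:
  assumes "y \<in> V" "z \<in> V"
  shows "R (\<lambda>x. of_bool (x = z)) y
    = (\<Sum>u\<in>V. a y u * a u z) - (lo + hi) * a y z + lo * hi * of_bool (y = z)"
proof -
  have "shift hi (\<lambda>x. of_bool (x = z)) = (\<lambda>x. a x z - hi * of_bool (x = z))"
    using assms(2) by (simp add: shift_def app_unit)
  moreover have "app (\<lambda>x. a x z - hi * of_bool (x = z)) y = (\<Sum>u\<in>V. a y u * a u z) - hi * a y z"
    unfolding app_diff app_scale app_unit[OF assms(2)] by (simp add: app_def)
  ultimately show ?thesis
    by (simp add: R_def shift_def algebra_simps)
qed

lemma R_centred_unit:
  assumes "y \<in> V" "z \<in> V"
  shows "R (centred_unit z) y = (\<Sum>u\<in>V. a y u * a u z) - (lo + hi) * a y z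
    + lo * hi * of_bool (y = z) - (r - lo) * (r - hi) / card V"
proof -
  have "R (\<lambda>_. 1 / card V) y = shift lo (\<lambda>_. (r - hi) * (1 / card V)) y"
    unfolding R_def using assms(1) by (intro shift_cong) (auto simp: shift_const)
  then have "R (\<lambda>_. 1 / card V) y = (r - lo) * (r - hi) / card V"
    using assms(1) by (simp add: shift_const)
  moreover have "R (centred_unit z) y = R (\<lambda>x. of_bool (x = z)) y - R (\<lambda>_. 1 / card V) y"
    unfolding R_def centred_unit_def by (simp add: shift_diff)
  ultimately show ?thesis using R_unit[OF assms] by simp
qed

lemma ip_centred_unit_R:
  assumes "y \<in> V"
  shows "ip (centred_unit y) (R (centred_unit y)) = gap"
proof -
  have "(\<Sum>u\<in>V. a y u * a u y) = (\<Sum>u\<in>V. a y u)"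
    using zero_one[OF assms] sym[OF assms]
    by (intro sum.cong refl) (metis mult_zero_left mult_1)
  then show ?thesis
    using assms row_sum[OF assms] loopless[OF assms]
    by (simp add: ip_centred_unit sum_zero_R sum_zero_centred_unit R_centred_unit gap_def)
qed

lemma gap_nonpos: "gap \<le> 0"
  using nonempty ip_centred_unit_R ip_R_nonpos sum_zero_centred_unit by (metis ex_in_conv)

text \<open>A negative semidefinite form that vanishes at p has R p = 0, since moving from p in the
  direction R p would otherwise make it positive. Applied to all centred units, and with
  \<open>R\<close> moved across the inner product, this annihilates every vector of sum 0.\<close>

lemma gap_eq_0_iff: "gap = 0 \<longleftrightarrow> (\<forall>w. sum_zero w \<longrightarrow> (\<forall>x\<in>V. R w x = 0))"
proof
  assume "\<forall>w. sum_zero w \<longrightarrow> (\<forall>x\<in>V. R w x = 0)"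
  moreover obtain y where y: "y \<in> V" using nonempty by blast
  ultimately have "R (centred_unit y) y = 0" using sum_zero_centred_unit by blast
  then show "gap = 0"
    using y ip_centred_unit_R[OF y] by (simp add: ip_centred_unit sum_zero_R sum_zero_centred_unit)
next
  assume gap: "gap = 0"
  have R0: "\<forall>x\<in>V. R (centred_unit y) x = 0" if y: "y \<in> V" for y
  proof (rule ccontr)
    define p where "p = centred_unit y"
    define z where "z = R p"
    define q where "q = ip z (R z)"
    assume "\<not> ?thesis"
    then have pos: "ip z z > 0"
      using ip_nonneg[of z] ip_self_eq_0_iff[of z] by (auto simp: z_def p_def)
    \<comment> \<open>The form at p + t z is 2 t |z|^2 + t^2 q with q \<le> 0. This t is small
      enough for the linear term to dominate, and the 1 in the denominator covers q = 0.\<close>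
    define t where "t = ip z z / (1 - q)"
    have p: "sum_zero p" and z: "sum_zero z"
      using y by (auto simp: p_def z_def intro: sum_zero_R sum_zero_centred_unit)
    have q: "q \<le> 0" unfolding q_def using z by (rule ip_R_nonpos)
    have t: "t > 0" using pos q by (simp add: t_def)
    have "R (\<lambda>x. p x + t * z x) = (\<lambda>x. z x + t * R z x)"
      unfolding z_def R_def by (simp add: shift_add shift_scale)
    then have "ip (\<lambda>x. p x + t * z x) (R (\<lambda>x. p x + t * z x)) = ip p z + 2 * t * ip z z + t\<^sup>2 * q"
      using ip_R[of p z] by (simp add: ip_add ip_scale q_def power2_eq_square algebra_simps flip: z_def)
    moreover have "ip p z = 0" using ip_centred_unit_R[OF y] gap by (simp add: p_def z_def)
    moreover have "sum_zero (\<lambda>x. p x + t * z x)"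
      using p z by (simp add: sum_zero_def sum.distrib flip: sum_distrib_left)
    ultimately have "t * (2 * ip z z + t * q) \<le> 0"
      using ip_R_nonpos[of "\<lambda>x. p x + t * z x"] by (simp add: power2_eq_square algebra_simps)
    then have "2 * ip z z + t * q \<le> 0" using t by (simp add: mult_le_0_iff)
    moreover have "t * (- q) \<le> ip z z" using pos q by (simp add: t_def field_simps)
    ultimately show False using pos by simp
  qed
  show "\<forall>w. sum_zero w \<longrightarrow> (\<forall>x\<in>V. R w x = 0)"
  proof (intro allI impI ballI)
    fix w y assume w: "sum_zero w" and y: "y \<in> V"
    have "R w y = ip (R (centred_unit y)) w"
      using w y by (simp add: ip_R ip_centred_unit sum_zero_R)
    also have "\<dots> = 0" using R0[OF y] by (simp add: ip_def)
    finally show "R w y = 0" .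
  qed
qed

text \<open>If A acts as the scalar s on vectors of sum 0, testing it on the difference of two unit
  vectors fixes every off-diagonal entry. An edge and a nonedge cannot both satisfy this.\<close>

lemma shift_eq_0_imp_constant:
  assumes "\<And>w x. sum_zero w \<Longrightarrow> x \<in> V \<Longrightarrow> shift s w x = 0"
    and "x \<in> V" "y \<in> V" "x \<noteq> y"
  shows "a x y = - s"
proof -
  define w where "w = (\<lambda>u. of_bool (u = x) - of_bool (u = y) :: real)"
  have "sum_zero w" using assms(2,3) by (simp add: sum_zero_def w_def sum_subtractf of_bool_def)
  then have "shift s w x = 0" using assms by blast
  then show ?thesis
    using assms(2-4) loopless
    by (simp add: w_def shift_def app_diff app_unit)
qed

text \<open>Summing an eigenvector equation over V shows that its eigenvalue is r or its vector has
  sum 0, where (A - lo) (A - hi) vanishes. Given an edge and a nonedge, neither factor vanishes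
  there by itself, and the image of one factor consists of eigenvectors for the root of the
  other.\<close>

lemma eigenvals_if_gap_eq_0:
  assumes "gap = 0"
    and adj: "x \<in> V" "y \<in> V" "a x y = 1"
    and nonadj: "x' \<in> V" "y' \<in> V" "x' \<noteq> y'" "a x' y' = 0"
  shows "eigenvals = {r, lo, hi}"
proof -
  have R0: "R w x = 0" if "sum_zero w" "x \<in> V" for w x
    using assms(1) that by (simp add: gap_eq_0_iff)
  have sub: "s \<in> {r, lo, hi}" if s: "s \<in> eigenvals" for s
  proof -
    obtain v x where v: "eigvec s v" "x \<in> V" "v x \<noteq> 0" using s by (auto simp: eigenvals_def)
    have "(\<Sum>x\<in>V. app v x) = s * (\<Sum>x\<in>V. v x)"
      using v(1) by (auto simp: eigvec_def sum_distrib_left)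
    then have "s = r \<or> sum_zero v" by (auto simp: sum_app sum_zero_def)
    moreover have "s = lo \<or> s = hi" if "sum_zero v"
      using R0[OF that v(2)] shifts_eigvec[OF v(1,2), of "[lo, hi]"] v(3) by (auto simp: R_def)
    ultimately show ?thesis by blast
  qed
  have "x \<noteq> y" using loopless[OF adj(1)] adj by auto
  have ex: "\<exists>w x. sum_zero w \<and> x \<in> V \<and> shift s w x \<noteq> 0" for s
    using shift_eq_0_imp_constant[of s x y] shift_eq_0_imp_constant[of s x' y'] adj nonadj \<open>x \<noteq> y\<close>
    by fastforce
  have "lo \<in> eigenvals"
  proof -
    obtain w x where w: "sum_zero w" "x \<in> V" "shift hi w x \<noteq> 0" using ex by blast
    have "eigvec lo (shift hi w)"
      using R0[OF w(1)] by (simp add: eigvec_iff_shift R_def)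
    then show ?thesis using w by (auto simp: eigenvals_def)
  qed
  moreover have "hi \<in> eigenvals"
  proof -
    obtain w x where w: "sum_zero w" "x \<in> V" "shift lo w x \<noteq> 0" using ex by blast
    have "eigvec hi (shift lo w)"
      using R0[OF w(1)] by (simp add: eigvec_iff_shift R_def shift_commute)
    then show ?thesis using w by (auto simp: eigenvals_def)
  qed
  moreover have "r \<in> eigenvals"
  proof -
    have "eigvec r (\<lambda>_. 1)" by (simp add: eigvec_def app_def row_sum)
    then show ?thesis using adj(1) by (auto simp: eigenvals_def intro!: exI[of _ "\<lambda>_. 1"])
  qed
  ultimately show ?thesis using sub by blast
qed

text \<open>The product of the three factors A - r, A - lo, A - hi is zero, so R w is an
  r-eigenvector, again of sum 0. If hi < r, the upper bound forces it to vanish; if hi = r, the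
  factor A - r occurs twice, and by symmetry one copy suffices.\<close>

lemma gap_eq_0_if_eigenvals:
  assumes "eigenvals = {r, lo, hi}"
  shows "gap = 0"
  unfolding gap_eq_0_iff
proof (intro allI impI)
  fix w assume w: "sum_zero w"
  have 0: "\<forall>x\<in>V. shift r (R w) x = 0"
    using shifts_eigenvals_eq_0[of "[r, lo, hi]" _ w] assms by (simp add: R_def)
  show "\<forall>x\<in>V. R w x = 0"
  proof (cases "hi = r")
    case True
    have R: "R w = shift hi (shift lo w)" unfolding R_def by (rule shift_commute)
    show ?thesis using shift_eq_0D[of hi "shift lo w"] 0 unfolding R True[symmetric] by blast
  next
    case False
    have "hi \<le> r" using abs_eigenval_le[of hi] assms by simp
    have "r * ip (R w) (R w) \<le> hi * ip (R w) (R w)"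
      using upper[OF sum_zero_R[OF w]] 0 by (simp add: ip_eigvec flip: eigvec_iff_shift)
    then have "(r - hi) * ip (R w) (R w) \<le> 0" by (simp add: algebra_simps)
    then have "ip (R w) (R w) = 0"
      using \<open>hi \<le> r\<close> False ip_nonneg[of "R w"] by (auto simp: mult_le_0_iff)
    then show ?thesis by (simp add: ip_self_eq_0_iff)
  qed
qed

text \<open>The off-diagonal entries of \<open>R\<close> on centred units vanish, which expresses
  those of A^2 by those of A. This is the defining condition of strong regularity on common
  neighbours.\<close>

lemma common_count_if_gap_eq_0:
  assumes "gap = 0" "y \<in> V" "z \<in> V" "y \<noteq> z"
  shows "(\<Sum>u\<in>V. a y u * a u z) = (lo + hi) * a y z + (r - lo) * (r - hi) / card V"
proof -
  have "R (centred_unit z) y = 0"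
    using assms sum_zero_centred_unit by (auto simp: gap_eq_0_iff)
  then show ?thesis using R_centred_unit[OF assms(2,3)] assms(4) by simp
qed

end

section \<open>Distances and walks\<close>

text \<open>Defined on the whole type, so that restricting the index set to a neighbourhood turns
  the same function into the matrix of the local graph.\<close>

definition adj :: "('a, 'b) pre_digraph \<Rightarrow> 'a \<Rightarrow> 'a \<Rightarrow> real" where
  "adj G x y = of_bool (x \<rightarrow>\<^bsub>G\<^esub> y)"

context graph
begin

lemma mem_neighbors: "y \<in> neighbors G x \<longleftrightarrow> x \<rightarrow>\<^bsub>G\<^esub> y"
  using adj_in_verts by (auto simp: neighbors_def)

lemma dominates_sym: "x \<rightarrow>\<^bsub>G\<^esub> y \<Longrightarrow> y \<rightarrow>\<^bsub>G\<^esub> x"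
  using arcs_ends_symmetric[OF sym_arcs] .

lemma neighbors_sym: "y \<in> neighbors G x \<longleftrightarrow> x \<in> neighbors G y"
  using dominates_sym by (auto simp: mem_neighbors)

lemma neighbors_subset: "neighbors G x \<subseteq> verts G"
  by (auto simp: neighbors_def)

lemma finite_neighbors [simp]: "finite (neighbors G x)"
  using neighbors_subset finite_verts by (rule finite_subset)

lemma not_mem_neighbors_self: "x \<notin> neighbors G x"
  using adj_not_same by (auto simp: mem_neighbors)

lemma adj_neighbors: "adj G x y = of_bool (y \<in> neighbors G x)"
  by (simp add: adj_def mem_neighbors)

lemma adj_commute: "adj G x y = adj G y x"
  using dominates_sym by (auto simp: adj_def)

lemma sum_adj: "finite S \<Longrightarrow> (\<Sum>y\<in>S. adj G x y) = card (S \<inter> neighbors G x)"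
  unfolding adj_neighbors by (simp add: sum_of_bool_eq)

lemma symmetric_matrix_adj: "finite S \<Longrightarrow> symmetric_matrix S (adj G)"
  by unfold_locales (auto intro: adj_commute)

section \<open>Distances 0, 1 and 2\<close>

lemma graph_dist_eq: "graph_dist G x y = (INF p\<in>{p. awalk x p y}. ereal (real (length p)))"
  by (simp add: graph_dist_def \<mu>_def awalk_cost_def sum_list_triv)

lemma graph_dist_le: "awalk x p y \<Longrightarrow> graph_dist G x y \<le> ereal (real (length p))"
  unfolding graph_dist_eq by (intro INF_lower) simp

lemma graph_dist_ge:
  "(\<And>p. awalk x p y \<Longrightarrow> n \<le> length p) \<Longrightarrow> ereal (real n) \<le> graph_dist G x y"
  unfolding graph_dist_eq by (intro INF_greatest) auto

lemma awalk_arc: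
  assumes "x \<rightarrow>\<^bsub>G\<^esub> y"
  obtains e where "awalk x [e] y"
proof -
  obtain e where "e \<in> arcs G" "tail G e = x" "head G e = y" using assms by auto
  then show thesis using that[of e] by (auto simp: awalk_Cons_iff awalk_Nil_iff)
qed

lemma graph_dist_self: "x \<in> verts G \<Longrightarrow> graph_dist G x x = 0"
  using graph_dist_le[of x "[]" x] graph_dist_ge[of x x 0]
  by (intro antisym) (auto simp: awalk_Nil_iff zero_ereal_def)

lemma graph_dist_adjacent:
  assumes "x \<rightarrow>\<^bsub>G\<^esub> y"
  shows "graph_dist G x y = 1"
proof (rule antisym)
  obtain e where "awalk x [e] y" using awalk_arc[OF assms] .
  from graph_dist_le[OF this] show "graph_dist G x y \<le> 1" by (simp add: one_ereal_def)
  have "x \<noteq> y" using assms adj_not_same by blast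
  then have "1 \<le> length p" if "awalk x p y" for p
    using that by (cases p) (auto simp: awalk_Nil_iff)
  then show "1 \<le> graph_dist G x y" using graph_dist_ge[of x y 1] by (simp add: one_ereal_def)
qed

lemma graph_dist_eq_2:
  assumes "x \<noteq> y" "\<not> x \<rightarrow>\<^bsub>G\<^esub> y" "x \<rightarrow>\<^bsub>G\<^esub> z" "z \<rightarrow>\<^bsub>G\<^esub> y"
  shows "graph_dist G x y = 2"
proof (rule antisym)
  obtain e f where "awalk x [e] z" "awalk z [f] y"
    using awalk_arc[OF assms(3)] awalk_arc[OF assms(4)] by metis
  then have "awalk x ([e] @ [f]) y" by (rule awalk_appendI)
  from graph_dist_le[OF this] show "graph_dist G x y \<le> 2" by simp
  have "2 \<le> length p" if "awalk x p y" for p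
  proof (rule ccontr)
    assume "\<not> 2 \<le> length p"
    then consider "p = []" | e where "p = [e]" by (cases p; cases "tl p") auto
    then show False
    proof cases
      case 1
      then show ?thesis using that assms(1) by (simp add: awalk_Nil_iff)
    next
      case 2
      then have "x \<rightarrow>\<^bsub>G\<^esub> y"
        using that by (auto simp: awalk_Cons_iff awalk_Nil_iff intro: in_arcs_imp_in_arcs_ends)
      then show ?thesis using assms(2) by simp
    qed
  qed
  then show "2 \<le> graph_dist G x y" using graph_dist_ge[of x y 2] by simp
qed

lemma finite_walks: "finite {p. awalk x p y \<and> length p = l}"
  by (rule finite_subset[OF _ finite_lists_length_eq[OF finite_arcs, of l]]) (auto simp: awalk_def)

text \<open>Walks are sorted by their first arc. As there are no parallel arcs, exactly one arc
  \<open>e z\<close> leads to each neighbour z.\<close>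

lemma num_walks_Suc:
  "num_walks G (Suc l) x y = (\<Sum>z\<in>neighbors G x. num_walks G l z y)"
proof -
  define W where "W z = {p. awalk z p y \<and> length p = l}" for z
  have "\<exists>e. e \<in> arcs G \<and> tail G e = x \<and> head G e = z" if "z \<in> neighbors G x" for z
    using that by (auto simp: mem_neighbors)
  then obtain e where e: "\<And>z. z \<in> neighbors G x \<Longrightarrow> e z \<in> arcs G \<and> tail G (e z) = x \<and> head G (e z) = z"
    by metis
  have "{p. awalk x p y \<and> length p = Suc l} = (\<Union>z\<in>neighbors G x. (#) (e z) ` W z)"
  proof (intro Set.set_eqI iffI)
    fix p assume p: "p \<in> {p. awalk x p y \<and> length p = Suc l}"
    then obtain f q where f: "p = f # q" by (cases p) auto
    then have f': "f \<in> arcs G" "tail G f = x" "q \<in> W (head G f)"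
      using p by (auto simp: awalk_Cons_iff W_def)
    then have "head G f \<in> neighbors G x"
      by (auto simp: mem_neighbors intro: in_arcs_imp_in_arcs_ends)
    moreover from this have "f = e (head G f)"
      using e f' by (intro no_multi_arcs) (auto simp: arc_to_ends_def)
    ultimately show "p \<in> (\<Union>z\<in>neighbors G x. (#) (e z) ` W z)" using f f' by blast
  next
    fix p assume "p \<in> (\<Union>z\<in>neighbors G x. (#) (e z) ` W z)"
    then show "p \<in> {p. awalk x p y \<and> length p = Suc l}"
      using e by (auto simp: W_def awalk_Cons_iff)
  qed
  moreover have "finite (W z)" for z unfolding W_def by (rule finite_walks)
  moreover have "(#) (e z) ` W z \<inter> (#) (e z') ` W z' = {}"
    if "z \<in> neighbors G x" "z' \<in> neighbors G x" "z \<noteq> z'" for z z'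
  proof -
    have "e z \<noteq> e z'" using e[OF that(1)] e[OF that(2)] that(3) by metis
    then show ?thesis by blast
  qed
  ultimately have "num_walks G (Suc l) x y = (\<Sum>z\<in>neighbors G x. card ((#) (e z) ` W z))"
    unfolding num_walks_def by (simp add: card_UN_disjoint)
  also have "\<dots> = (\<Sum>z\<in>neighbors G x. num_walks G l z y)"
    by (simp add: card_image num_walks_def W_def)
  finally show ?thesis .
qed

section \<open>Local graphs as induced subgraphs\<close>

lemma graph_local_graph: "graph (local_graph G x)"
proof -
  have ind: "induced_subgraph (local_graph G x) G"
    unfolding local_graph_def using neighbors_subset by (rule induced_induce)
  interpret L: digraph "local_graph G x" using ind by (rule digraphI_induced)
  show ?thesis using induced_graph_imp_symmetric[OF sym_arcs ind] by (rule L.graphI)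
qed

lemma verts_local_graph: "verts (local_graph G x) = neighbors G x"
  by (simp add: local_graph_def)

lemma dominates_local_graph:
  "y \<in> neighbors G x \<Longrightarrow> z \<in> neighbors G x \<Longrightarrow> y \<rightarrow>\<^bsub>local_graph G x\<^esub> z \<longleftrightarrow> y \<rightarrow>\<^bsub>G\<^esub> z"
  by (auto simp: local_graph_def arcs_ends_conv)

lemma neighbors_local_graph:
  "y \<in> neighbors G x \<Longrightarrow> neighbors (local_graph G x) y = neighbors G x \<inter> neighbors G y"
  by (auto simp: neighbors_def[of "local_graph G x"] verts_local_graph dominates_local_graph
    mem_neighbors)

end

section \<open>Two-walk-regular graphs\<close>

locale two_walk_regular_graph = graph G for G :: "('a, 'b) pre_digraph" +
  fixes k a1 :: nat
  assumes two_walk_regular: "two_walk_regular G"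
    and regular: "regular_of_valency G k"
    and card_common_neighbors:
      "x \<in> verts G \<Longrightarrow> y \<in> verts G \<Longrightarrow> x \<rightarrow>\<^bsub>G\<^esub> y \<Longrightarrow> card (common_neighbors G x y) = a1"
begin

lemma card_neighbors: "x \<in> verts G \<Longrightarrow> card (neighbors G x) = k"
  using regular by (simp add: regular_of_valency_def)

lemma card_neighbors_Int: "y \<in> neighbors G x \<Longrightarrow> card (neighbors G x \<inter> neighbors G y) = a1"
  using card_common_neighbors[of x y] adj_in_verts[of x y]
  by (simp add: mem_neighbors common_neighbors_def)

sublocale A: regular_matrix "verts G" "adj G" "real k"
proof (intro regular_matrix.intro regular_matrix_axioms.intro symmetric_matrix_adj)
  fix x assume "x \<in> verts G"
  then show "(\<Sum>y\<in>verts G. adj G x y) = real k"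
    using neighbors_subset[of x] by (simp add: sum_adj Int_absorb1 card_neighbors)
qed (auto simp: adj_def)

lemma regular_matrix_local: "regular_matrix (neighbors G x) (adj G) (real a1)"
proof (intro regular_matrix.intro regular_matrix_axioms.intro symmetric_matrix_adj)
  fix y assume "y \<in> neighbors G x"
  then show "(\<Sum>z\<in>neighbors G x. adj G y z) = real a1"
    by (simp add: sum_adj card_neighbors_Int)
qed (auto simp: adj_def)

lemma app_eq: "A.app v x = (\<Sum>y\<in>neighbors G x. v y)"
proof -
  have "A.app v x = (\<Sum>y\<in>neighbors G x. adj G x y * v y)"
    unfolding A.app_def using neighbors_subset
    by (intro sum.mono_neutral_right) (auto simp: adj_neighbors)
  then show ?thesis by (simp add: adj_neighbors)
qed

abbreviation unit :: "'a \<Rightarrow> 'a \<Rightarrow> real" where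
  "unit y \<equiv> (\<lambda>x. of_bool (x = y))"

lemma num_walks_eq_app:
  assumes "x \<in> verts G" "y \<in> verts G"
  shows "real (num_walks G l x y) = (A.app ^^ l) (unit y) x"
  using assms(1)
proof (induction l arbitrary: x)
  case 0
  have "{p. awalk x p y \<and> length p = 0} = (if x = y then {[]} else {})"
    using 0 by (auto simp: awalk_Nil_iff)
  then show ?case by (simp add: num_walks_def)
next
  case (Suc l)
  then show ?case
    using neighbors_subset[of x] by (auto simp: num_walks_Suc app_eq intro!: sum.cong)
qed

text \<open>Walk counts are the entries of the powers of A, which settles the empty list. The
  exponent \<open>l\<close> stays arbitrary because each further factor A - s also calls on the next
  higher power.\<close>

lemma app_shifts_eq_if_graph_dist_eq:
  assumes "x \<in> verts G" "y \<in> verts G" "x' \<in> verts G" "y' \<in> verts G"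
    and "graph_dist G x y \<le> 2" "graph_dist G x' y' = graph_dist G x y"
  shows "(A.app ^^ l) (A.shifts ss (unit y)) x = (A.app ^^ l) (A.shifts ss (unit y')) x'"
proof (induction ss arbitrary: l)
  case Nil
  have "num_walks G l x y = num_walks G l x' y'"
    using assms two_walk_regular unfolding two_walk_regular_def by metis
  then show ?case using assms num_walks_eq_app by (metis A.shifts_simps(1))
qed (simp only: A.shifts_simps A.app_funpow_shift)

lemma reachable: "x \<in> verts G \<Longrightarrow> y \<in> verts G \<Longrightarrow> x \<rightarrow>\<^sup>*\<^bsub>G\<^esub> y"
  using symmetric_connected_imp_strongly_connected[OF sym_arcs] two_walk_regular
  unfolding two_walk_regular_def by blast

lemma constant_if_constant_on_edges:
  assumes "\<And>x y. x \<rightarrow>\<^bsub>G\<^esub> y \<Longrightarrow> f x = f y" "x \<in> verts G" "y \<in> verts G"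
  shows "f x = f y"
  using reachable[OF assms(2,3)] by (induction rule: reachable_induct) (auto dest: assms(1))

text \<open>Without an induced path on three vertices adjacency would be transitive between distinct
  vertices, and by connectedness all distances would be at most 1.\<close>

lemma ex_distance_2:
  obtains x y z where "x \<rightarrow>\<^bsub>G\<^esub> y" "y \<rightarrow>\<^bsub>G\<^esub> z" "x \<noteq> z" "\<not> x \<rightarrow>\<^bsub>G\<^esub> z"
proof (rule ccontr)
  assume "\<not> thesis"
  then have "\<forall>x y z. x \<rightarrow>\<^bsub>G\<^esub> y \<longrightarrow> y \<rightarrow>\<^bsub>G\<^esub> z \<longrightarrow> x \<noteq> z \<longrightarrow> x \<rightarrow>\<^bsub>G\<^esub> z"
    using that by blast
  then have trans: "x \<rightarrow>\<^bsub>G\<^esub> z" if "x \<rightarrow>\<^bsub>G\<^esub> y" "y \<rightarrow>\<^bsub>G\<^esub> z" "x \<noteq> z" for x y z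
    using that by blast
  have "graph_dist G x y \<le> 1" if xy: "x \<in> verts G" "y \<in> verts G" for x y
  proof -
    have "x = y \<or> x \<rightarrow>\<^bsub>G\<^esub> y"
      using reachable[OF xy] by (induction rule: reachable_induct) (auto dest: trans)
    then show ?thesis using xy by (auto simp: graph_dist_self graph_dist_adjacent)
  qed
  then have "diameter G \<le> 1" unfolding diameter_def by (intro SUP_least) auto
  moreover have "2 \<le> diameter G" using two_walk_regular by (simp add: two_walk_regular_def)
  ultimately have "(2 :: ereal) \<le> 1" by (rule order_trans[rotated])
  then show False by simp
qed

text \<open>The middle vertex y of an induced path x, y, z is adjacent to x, to z and to the a1
  common neighbours of x and y; x and z are not among the latter.\<close>

lemma a1_less: "a1 + 1 < k"
proof -
  obtain x y z where xyz: "x \<rightarrow>\<^bsub>G\<^esub> y" "y \<rightarrow>\<^bsub>G\<^esub> z" "x \<noteq> z" "\<not> x \<rightarrow>\<^bsub>G\<^esub> z" using ex_distance_2 .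
  have "insert x (insert z (neighbors G y \<inter> neighbors G x)) \<subseteq> neighbors G y"
    using xyz dominates_sym by (auto simp: mem_neighbors)
  then have "card (insert x (insert z (neighbors G y \<inter> neighbors G x))) \<le> card (neighbors G y)"
    by (intro card_mono) auto
  moreover have "card (neighbors G y \<inter> neighbors G x) = a1"
    using xyz dominates_sym by (intro card_neighbors_Int) (auto simp: mem_neighbors)
  ultimately show ?thesis
    using xyz not_mem_neighbors_self[of x] adj_in_verts[OF xyz(1)]
    by (simp add: card_neighbors mem_neighbors)
qed

text \<open>Up to scaling, \<open>E\<close> below is the projection onto the eigenspace of \<open>\<theta>\<close>: with the
  polynomial \<open>N = \<Prod>\<^bsub>s \<noteq> \<theta>\<^esub> (A - s)\<close> in \<open>A\<close> it is \<open>N\<^sup>2\<close>, hence positive semidefinite.\<close>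

lemma eigenprojection:
  assumes "finite A.eigenvals" "\<theta> \<in> A.eigenvals"
  obtains E \<alpha>1 \<alpha>2 where
    "\<And>S w. S \<subseteq> verts G \<Longrightarrow> 0 \<le> (\<Sum>x\<in>S. \<Sum>y\<in>S. w x * E x y * w y)"
    "\<And>x y. x \<in> verts G \<Longrightarrow> y \<in> verts G \<Longrightarrow> (\<Sum>z\<in>neighbors G x. E z y) = \<theta> * E x y"
    "\<And>x. x \<in> verts G \<Longrightarrow> E x x = (1 :: real)"
    "\<And>x y. x \<rightarrow>\<^bsub>G\<^esub> y \<Longrightarrow> E x y = \<alpha>1"
    "\<And>x y z. x \<rightarrow>\<^bsub>G\<^esub> z \<Longrightarrow> z \<rightarrow>\<^bsub>G\<^esub> y \<Longrightarrow> x \<noteq> y \<Longrightarrow> \<not> x \<rightarrow>\<^bsub>G\<^esub> y \<Longrightarrow> E x y = \<alpha>2"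
proof -
  obtain ss where ss: "set ss = A.eigenvals - {\<theta>}"
    using finite_list[of "A.eigenvals - {\<theta>}"] assms(1) by auto
  define F where "F x y = A.shifts (ss @ ss) (unit y) x" for x y
  obtain x0 y0 z0 where xyz: "x0 \<rightarrow>\<^bsub>G\<^esub> y0" "y0 \<rightarrow>\<^bsub>G\<^esub> z0" "x0 \<noteq> z0" "\<not> x0 \<rightarrow>\<^bsub>G\<^esub> z0"
    using ex_distance_2 .
  then have verts: "x0 \<in> verts G" "y0 \<in> verts G" "z0 \<in> verts G" using adj_in_verts by blast+
  have F_dist: "F x y = F x' y'"
    if "x \<in> verts G" "y \<in> verts G" "x' \<in> verts G" "y' \<in> verts G"
      "graph_dist G x y \<le> 2" "graph_dist G x' y' = graph_dist G x y" for x y x' y'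
    using app_shifts_eq_if_graph_dist_eq[OF that, of 0 "ss @ ss"] by (simp add: F_def)
  have F_ip: "F x y = A.ip (A.shifts ss (unit x)) (A.shifts ss (unit y))"
    if "x \<in> verts G" for x y
    using that A.ip_unit[of x] by (simp add: F_def A.ip_shifts)
  have F_diag: "F x x = F x0 x0" if "x \<in> verts G" for x
    using F_dist[of x0 x0 x x] that verts by (simp add: graph_dist_self)
  \<comment> \<open>All diagonal entries agree, so a zero here would mean that the product of the A
    - s over s \<noteq> \<theta> kills every unit vector. But it multiplies a \<theta>-eigenvector
    by a product of nonzero numbers \<theta> - s.\<close>
  have "F x0 x0 \<noteq> 0"
  proof
    assume "F x0 x0 = 0"
    then have zero: "A.shifts ss (unit x) y = 0" if "x \<in> verts G" "y \<in> verts G" for x y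
      using F_diag[OF that(1)] F_ip[OF that(1)] that(2) by (simp add: A.ip_self_eq_0_iff)
    obtain v x where v: "A.eigvec \<theta> v" "x \<in> verts G" "v x \<noteq> 0"
      using assms(2) by (auto simp: A.eigenvals_def)
    have "A.shifts ss v x = A.ip (unit x) (A.shifts ss v)" using v(2) by (simp add: A.ip_unit)
    also have "\<dots> = A.ip (A.shifts ss (unit x)) v" by (simp add: A.ip_shifts)
    also have "\<dots> = 0" using zero v(2) by (simp add: A.ip_def)
    finally have "(\<Prod>s\<leftarrow>ss. \<theta> - s) = 0" using v by (simp add: A.shifts_eigvec)
    then have "\<theta> \<in> set ss" unfolding prod_list_zero_iff by auto
    then show False unfolding ss by blast
  qed
  moreover have "F x0 x0 \<ge> 0" unfolding F_ip[OF verts(1)] by (rule A.ip_nonneg)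
  ultimately have pos: "F x0 x0 > 0" by simp
  show thesis
  proof (rule that[of "\<lambda>x y. F x y / F x0 x0" "F x0 y0 / F x0 x0" "F x0 z0 / F x0 x0"])
    fix S and w :: "'a \<Rightarrow> real" assume S: "S \<subseteq> verts G"
    define u where "u = A.shifts ss (\<lambda>y. \<Sum>x\<in>S. w x * unit x y)"
    have u: "u = (\<lambda>y. \<Sum>x\<in>S. w x * A.shifts ss (unit x) y)"
      unfolding u_def A.shifts_sum A.shifts_scale ..
    have ip_u: "A.ip u v = (\<Sum>x\<in>S. w x * A.ip (A.shifts ss (unit x)) v)" for v
      unfolding u A.ip_sum A.ip_scale ..
    have "A.ip u u = (\<Sum>x\<in>S. w x * A.ip u (A.shifts ss (unit x)))"
      by (subst ip_u) (simp only: A.ip_commute[of u])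
    also have "\<dots> = (\<Sum>x\<in>S. \<Sum>y\<in>S. w y * F y x * w x)"
    proof (intro sum.cong refl)
      fix x assume "x \<in> S"
      have "A.ip u (A.shifts ss (unit x)) = (\<Sum>y\<in>S. w y * F y x)"
        unfolding ip_u using S F_ip by (intro sum.cong refl) auto
      then show "w x * A.ip u (A.shifts ss (unit x)) = (\<Sum>y\<in>S. w y * F y x * w x)"
        by (simp only: sum_distrib_right mult.commute[of "w x"])
    qed
    also have "\<dots> = (\<Sum>x\<in>S. \<Sum>y\<in>S. w x * F x y * w y)" by (rule sum.swap)
    finally have "0 \<le> (\<Sum>x\<in>S. \<Sum>y\<in>S. w x * F x y * w y) / F x0 x0"
      using A.ip_nonneg[of u] pos by simp
    then show "0 \<le> (\<Sum>x\<in>S. \<Sum>y\<in>S. w x * (F x y / F x0 x0) * w y)"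
      by (simp add: sum_divide_distrib)
  next
    fix x y assume xy: "x \<in> verts G" "y \<in> verts G"
    have "A.shift \<theta> (A.shifts (ss @ ss) (unit y)) x = 0"
      using A.shifts_eigenvals_eq_0[OF assms(1), of "\<theta> # ss @ ss" x "unit y"] ss xy by auto
    then have "(\<Sum>z\<in>neighbors G x. F z y) = \<theta> * F x y"
      by (simp add: A.shift_def app_eq F_def)
    then show "(\<Sum>z\<in>neighbors G x. F z y / F x0 x0) = \<theta> * (F x y / F x0 x0)"
      by (simp flip: sum_divide_distrib)
  next
    fix x assume "x \<in> verts G"
    then show "F x x / F x0 x0 = 1" using F_diag pos by simp
  next
    fix x y assume "x \<rightarrow>\<^bsub>G\<^esub> y"
    then show "F x y / F x0 x0 = F x0 y0 / F x0 x0"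
      using F_dist[of x0 y0 x y] adj_in_verts[of x y] xyz verts by (simp add: graph_dist_adjacent)
  next
    fix x y z assume "x \<rightarrow>\<^bsub>G\<^esub> z" "z \<rightarrow>\<^bsub>G\<^esub> y" "x \<noteq> y" "\<not> x \<rightarrow>\<^bsub>G\<^esub> y"
    then show "F x y / F x0 x0 = F x0 z0 / F x0 x0"
      using F_dist[of x0 z0 x y] adj_in_verts xyz verts
        graph_dist_eq_2[of x y z] graph_dist_eq_2[of x0 z0 y0] by simp
  qed
qed

section \<open>Positivity on the neighbourhood of a vertex\<close>

definition b1 :: real where
  "b1 = real k - 1 - real a1"

lemma b1_pos: "b1 > 0"
  using a1_less by (simp add: b1_def)

text \<open>\<open>\<alpha>1\<close> and \<open>\<alpha>2\<close> are the cosines of \<theta> at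
  distances 1 and 2: the entries of E when its diagonal is scaled to 1. The two equations are A E =
  \<theta> E read at a diagonal entry and at an edge.\<close>

lemma eigenspace_coefficients:
  assumes "finite A.eigenvals" "\<theta> \<in> A.eigenvals"
  obtains \<alpha>1 \<alpha>2 where "real k * \<alpha>1 = \<theta>" "1 + real a1 * \<alpha>1 + b1 * \<alpha>2 = \<theta> * \<alpha>1"
    "\<And>x w. x \<in> verts G \<Longrightarrow> (\<Sum>y\<in>neighbors G x. w y) = 0 \<Longrightarrow>
      0 \<le> (1 - \<alpha>2) * (\<Sum>y\<in>neighbors G x. w y * w y)
        + (\<alpha>1 - \<alpha>2) * (\<Sum>y\<in>neighbors G x. w y * (\<Sum>z\<in>neighbors G x. adj G y z * w z))"
proof -
  obtain E \<alpha>1 \<alpha>2 where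
    psd: "\<And>S w. S \<subseteq> verts G \<Longrightarrow> 0 \<le> (\<Sum>x\<in>S. \<Sum>y\<in>S. w x * E x y * w y)" and
    eig: "\<And>x y. x \<in> verts G \<Longrightarrow> y \<in> verts G \<Longrightarrow> (\<Sum>z\<in>neighbors G x. E z y) = \<theta> * E x y" and
    diag: "\<And>x. x \<in> verts G \<Longrightarrow> E x x = (1 :: real)" and
    edge: "\<And>x y. x \<rightarrow>\<^bsub>G\<^esub> y \<Longrightarrow> E x y = \<alpha>1" and
    dist2: "\<And>x y z. x \<rightarrow>\<^bsub>G\<^esub> z \<Longrightarrow> z \<rightarrow>\<^bsub>G\<^esub> y \<Longrightarrow> x \<noteq> y \<Longrightarrow> \<not> x \<rightarrow>\<^bsub>G\<^esub> y \<Longrightarrow> E x y = \<alpha>2"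
    by (rule eigenprojection[OF assms]) (rule that, assumption+)
  obtain x y where xy: "x \<rightarrow>\<^bsub>G\<^esub> y" using ex_distance_2 by blast
  have verts: "x \<in> verts G" "y \<in> verts G" using adj_in_verts[OF xy] by auto
  have 1: "real k * \<alpha>1 = \<theta>"
  proof -
    have "(\<Sum>z\<in>neighbors G x. E z x) = (\<Sum>z\<in>neighbors G x. \<alpha>1)"
      using edge dominates_sym by (intro sum.cong) (auto simp: mem_neighbors)
    then show ?thesis using eig[OF verts(1,1)] diag[OF verts(1)] verts by (simp add: card_neighbors)
  qed
  have 2: "1 + real a1 * \<alpha>1 + b1 * \<alpha>2 = \<theta> * \<alpha>1"
  proof -
    let ?N = "neighbors G x \<inter> neighbors G y" and ?M = "neighbors G x - insert y (neighbors G y)"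
    have y: "y \<in> neighbors G x" "y \<notin> neighbors G y"
      using xy not_mem_neighbors_self by (auto simp: mem_neighbors)
    \<comment> \<open>Seen from y, the neighbours of x are y itself, the a1 common neighbours at
      distance 1, and the remaining b1 vertices at distance 2 through x.\<close>
    have "neighbors G x = insert y (?N \<union> ?M)" using y by auto
    then have "(\<Sum>z\<in>neighbors G x. E z y) = (\<Sum>z\<in>insert y (?N \<union> ?M). E z y)" by simp
    also have "\<dots> = E y y + ((\<Sum>z\<in>?N. E z y) + (\<Sum>z\<in>?M. E z y))"
      using y by (subst sum.insert, simp, simp, subst sum.union_disjoint) auto
    also have "(\<Sum>z\<in>?N. E z y) = real a1 * \<alpha>1"
    proof -
      have "(\<Sum>z\<in>?N. E z y) = (\<Sum>z\<in>?N. \<alpha>1)"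
        using edge dominates_sym by (intro sum.cong) (auto simp: mem_neighbors)
      then show ?thesis using card_neighbors_Int[OF y(1)] by simp
    qed
    also have "(\<Sum>z\<in>?M. E z y) = b1 * \<alpha>2"
    proof -
      have "E z y = \<alpha>2" if "z \<in> ?M" for z
        using that xy dominates_sym by (intro dist2[of z x y]) (auto simp: mem_neighbors)
      moreover have "card ?M = k - (a1 + 1)"
      proof -
        have "?M = neighbors G x - insert y ?N" by auto
        moreover have "card (insert y ?N) = a1 + 1" using y card_neighbors_Int[OF y(1)] by simp
        ultimately show ?thesis using y verts by (simp add: card_Diff_subset card_neighbors)
      qed
      ultimately show ?thesis using a1_less by (simp add: b1_def of_nat_diff)
    qed
    finally show ?thesis using eig[OF verts] diag[OF verts(2)] edge[OF xy] by simp
  qed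
  have 3: "0 \<le> (1 - \<alpha>2) * (\<Sum>y\<in>neighbors G x. w y * w y)
        + (\<alpha>1 - \<alpha>2) * (\<Sum>y\<in>neighbors G x. w y * (\<Sum>z\<in>neighbors G x. adj G y z * w z))"
    if x: "x \<in> verts G" and w: "(\<Sum>y\<in>neighbors G x. w y) = 0" for x w
  proof -
    let ?N = "neighbors G x"
    \<comment> \<open>Distinct nonadjacent y and z have x as a common neighbour and are thus at
      distance 2. The last summand is constant and disappears against a vector of sum 0.\<close>
    have E: "E y z = (1 - \<alpha>2) * of_bool (y = z) + (\<alpha>1 - \<alpha>2) * adj G y z + \<alpha>2"
      if "y \<in> ?N" "z \<in> ?N" for y z
    proof -
      consider "y = z" | "y \<rightarrow>\<^bsub>G\<^esub> z" "y \<noteq> z" | "\<not> y \<rightarrow>\<^bsub>G\<^esub> z" "y \<noteq> z" by blast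
      then show ?thesis
      proof cases
        case 1
        then show ?thesis
          using that diag neighbors_subset not_mem_neighbors_self by (auto simp: adj_neighbors)
      next
        case 2
        then show ?thesis using edge by (simp add: adj_def)
      next
        case 3
        then show ?thesis
          using that dominates_sym by (subst dist2[of y x z]) (auto simp: mem_neighbors adj_def)
      qed
    qed
    have "(\<Sum>y\<in>?N. \<Sum>z\<in>?N. w y * E y z * w z)
        = (\<Sum>y\<in>?N. w y * ((1 - \<alpha>2) * w y + (\<alpha>1 - \<alpha>2) * (\<Sum>z\<in>?N. adj G y z * w z)))"
    proof (intro sum.cong refl)
      fix y assume y: "y \<in> ?N"
      have "(\<Sum>z\<in>?N. w y * E y z * w z)
          = (\<Sum>z\<in>?N. w y * ((1 - \<alpha>2) * (of_bool (y = z) * w z) + (\<alpha>1 - \<alpha>2) * (adj G y z * w z) + \<alpha>2 * w z))"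
        using y by (intro sum.cong refl) (simp only: E, simp add: algebra_simps)
      also have "\<dots> = w y * ((1 - \<alpha>2) * (\<Sum>z\<in>?N. of_bool (y = z) * w z)
          + (\<alpha>1 - \<alpha>2) * (\<Sum>z\<in>?N. adj G y z * w z) + \<alpha>2 * (\<Sum>z\<in>?N. w z))"
        by (simp only: sum.distrib sum_distrib_left[symmetric])
      also have "(\<Sum>z\<in>?N. of_bool (y = z) * w z) = w y"
        using y by (simp add: of_bool_def if_distrib[where f = "\<lambda>t. t * _"] cong: if_cong)
      finally show "(\<Sum>z\<in>?N. w y * E y z * w z)
          = w y * ((1 - \<alpha>2) * w y + (\<alpha>1 - \<alpha>2) * (\<Sum>z\<in>?N. adj G y z * w z))"
        using w by simp
    qed
    also have "\<dots> = (1 - \<alpha>2) * (\<Sum>y\<in>?N. w y * w y)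
        + (\<alpha>1 - \<alpha>2) * (\<Sum>y\<in>?N. w y * (\<Sum>z\<in>?N. adj G y z * w z))"
      unfolding sum_distrib_left[of "1 - \<alpha>2"] sum_distrib_left[of "\<alpha>1 - \<alpha>2" _ ?N] sum.distrib[symmetric]
      by (intro sum.cong refl) (simp add: algebra_simps sum_distrib_left)
    finally show ?thesis using psd[OF neighbors_subset, of w x] by simp
  qed
  show thesis using that[OF 1 2 3] by blast
qed

text \<open>After multiplication by k b1 > 0 and elimination of the cosines, both coefficients of
  the form contain the factor k - \<theta>. It is positive and can be cancelled.\<close>

lemma local_form_nonneg:
  assumes "finite A.eigenvals" "\<theta> \<in> A.eigenvals" "\<theta> < real k"
    and x: "x \<in> verts G" and w: "(\<Sum>y\<in>neighbors G x. w y) = 0"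
  shows "0 \<le> (\<theta> + 1 + b1) * (\<Sum>y\<in>neighbors G x. w y * w y)
    + (\<theta> + 1) * (\<Sum>y\<in>neighbors G x. w y * (\<Sum>z\<in>neighbors G x. adj G y z * w z))"
    (is "0 \<le> _ * ?P + _ * ?Q")
proof -
  obtain \<alpha>1 \<alpha>2 where \<alpha>: "real k * \<alpha>1 = \<theta>" "1 + real a1 * \<alpha>1 + b1 * \<alpha>2 = \<theta> * \<alpha>1"
    and form: "\<And>x w. x \<in> verts G \<Longrightarrow> (\<Sum>y\<in>neighbors G x. w y) = 0 \<Longrightarrow>
      0 \<le> (1 - \<alpha>2) * (\<Sum>y\<in>neighbors G x. w y * w y)
        + (\<alpha>1 - \<alpha>2) * (\<Sum>y\<in>neighbors G x. w y * (\<Sum>z\<in>neighbors G x. adj G y z * w z))"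
    by (rule eigenspace_coefficients[OF assms(1,2)]) (rule that, assumption+)
  have nonneg: "0 \<le> (1 - \<alpha>2) * ?P + (\<alpha>1 - \<alpha>2) * ?Q" using form[OF x w] .
  have kb: "real k = a1 + 1 + b1" by (simp add: b1_def)
  have "real k * (b1 * \<alpha>2) = \<theta> * (real k * \<alpha>1) - real k - real a1 * (real k * \<alpha>1)"
    using arg_cong[OF \<alpha>(2), of "\<lambda>t. real k * t"] by (simp add: algebra_simps)
  then have \<alpha>2: "real k * b1 * \<alpha>2 = \<theta> * \<theta> - real k - real a1 * \<theta>"
    unfolding \<alpha>(1) by (simp add: mult.assoc)
  have \<alpha>1: "real k * b1 * \<alpha>1 = b1 * \<theta>" using \<alpha>(1) by (simp add: mult_ac)
  have "0 \<le> real k * b1 * ((1 - \<alpha>2) * ?P + (\<alpha>1 - \<alpha>2) * ?Q)"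
    using nonneg b1_pos by (intro mult_nonneg_nonneg) auto
  also have "\<dots> = (real k * b1 - real k * b1 * \<alpha>2) * ?P + (real k * b1 * \<alpha>1 - real k * b1 * \<alpha>2) * ?Q"
    by (simp add: algebra_simps)
  also have "real k * b1 - real k * b1 * \<alpha>2 = (real k - \<theta>) * (\<theta> + 1 + b1)"
    unfolding \<alpha>2 unfolding kb by (simp add: algebra_simps)
  also have "real k * b1 * \<alpha>1 - real k * b1 * \<alpha>2 = (real k - \<theta>) * (\<theta> + 1)"
    unfolding \<alpha>1 \<alpha>2 unfolding kb by (simp add: algebra_simps)
  finally have "0 \<le> (real k - \<theta>) * ((\<theta> + 1 + b1) * ?P + (\<theta> + 1) * ?Q)"
    by (simp add: algebra_simps)
  then show ?thesis using assms(3) by (simp add: zero_le_mult_iff)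
qed

text \<open>The vector 1, -1, 1 along an induced path on three vertices has Rayleigh quotient
  -4/3.\<close>

lemma ex_eigenval_less_minus_1:
  assumes "finite A.eigenvals"
  obtains t where "t \<in> A.eigenvals" "t < -1"
proof -
  obtain x y z where xyz: "x \<rightarrow>\<^bsub>G\<^esub> y" "y \<rightarrow>\<^bsub>G\<^esub> z" "x \<noteq> z" "\<not> x \<rightarrow>\<^bsub>G\<^esub> z" using ex_distance_2 .
  then have verts: "x \<in> verts G" "y \<in> verts G" "z \<in> verts G" using adj_in_verts by blast+
  have "x \<noteq> y" "y \<noteq> z" using xyz adj_not_same by blast+
  have adj: "adj G x y = 1" "adj G y x = 1" "adj G y z = 1" "adj G z y = 1" "adj G x z = 0" "adj G z x = 0"
    "adj G x x = 0" "adj G y y = 0" "adj G z z = 0"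
    using xyz dominates_sym adj_not_same by (auto simp: adj_def)
  define v where "v = (\<lambda>u. (unit x u - unit y u) + unit z u)"
  have vv: "A.ip v v = 3"
    unfolding v_def A.ip_add A.ip_diff using verts \<open>x \<noteq> y\<close> \<open>y \<noteq> z\<close> \<open>x \<noteq> z\<close>
    by (simp add: A.ip_unit)
  have "A.app v = (\<lambda>u. (adj G u x - adj G u y) + adj G u z)"
    unfolding v_def A.app_add A.app_diff using verts by (simp add: A.app_unit)
  then have vAv: "A.ip v (A.app v) = -4"
    using verts adj by (simp add: v_def A.ip_add(1) A.ip_diff(1) A.ip_unit)
  obtain u where "\<And>t. A.eigvec t (u t)" and u: "A.ip v v = (\<Sum>t\<in>A.eigenvals. A.ip (u t) (u t))"
    "A.ip v (A.app v) = (\<Sum>t\<in>A.eigenvals. t * A.ip (u t) (u t))"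
    and "\<And>t. t \<in> A.eigenvals \<Longrightarrow> A.ip v (u t) = A.ip (u t) (u t)"
    by (rule A.spectral_decomposition_orthogonal[OF assms]) (rule that, assumption+)
  show thesis
  proof (rule ccontr)
    assume "\<not> thesis"
    then have "\<forall>t\<in>A.eigenvals. \<not> t < -1" using that by blast
    then have "-1 \<le> t" if "t \<in> A.eigenvals" for t using that by force
    then have "(\<Sum>t\<in>A.eigenvals. (-1) * A.ip (u t) (u t)) \<le> (\<Sum>t\<in>A.eigenvals. t * A.ip (u t) (u t))"
      by (intro sum_mono mult_right_mono A.ip_nonneg)
    then have "- A.ip v v \<le> A.ip v (A.app v)" unfolding u by (simp add: sum_negf)
    then show False using vv vAv by simp
  qed
qed

text \<open>For x and z at distance 2, the difference of their unit vectors has Rayleigh quotient 0.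
  By connectedness the k-eigenvectors are constant, so it has no component there, and the other
  eigenvalues cannot all be negative.\<close>

lemma ex_nonneg_eigenval:
  assumes "finite A.eigenvals" "real k \<in> A.eigenvals"
  obtains s where "s \<in> A.eigenvals" "s \<noteq> real k" "s \<ge> 0"
proof -
  obtain x y z where xyz: "x \<rightarrow>\<^bsub>G\<^esub> y" "y \<rightarrow>\<^bsub>G\<^esub> z" "x \<noteq> z" "\<not> x \<rightarrow>\<^bsub>G\<^esub> z" using ex_distance_2 .
  then have verts: "x \<in> verts G" "z \<in> verts G" using adj_in_verts by blast+
  have adj: "adj G x z = 0" "adj G z x = 0" "adj G x x = 0" "adj G z z = 0"
    using xyz dominates_sym adj_not_same by (auto simp: adj_def)
  define v where "v = (\<lambda>u. unit x u - unit z u)"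
  have vv: "A.ip v v = 2"
    unfolding v_def A.ip_diff using verts \<open>x \<noteq> z\<close> by (simp add: A.ip_unit)
  have "A.app v = (\<lambda>u. adj G u x - adj G u z)"
    unfolding v_def A.app_diff using verts by (simp add: A.app_unit)
  then have vAv: "A.ip v (A.app v) = 0"
    using verts adj by (simp add: v_def A.ip_diff(1) A.ip_unit)
  obtain u where eig: "\<And>t. A.eigvec t (u t)"
    and u: "A.ip v v = (\<Sum>t\<in>A.eigenvals. A.ip (u t) (u t))"
    "A.ip v (A.app v) = (\<Sum>t\<in>A.eigenvals. t * A.ip (u t) (u t))"
    and proj: "\<And>t. t \<in> A.eigenvals \<Longrightarrow> A.ip v (u t) = A.ip (u t) (u t)"
    by (rule A.spectral_decomposition_orthogonal[OF assms(1)]) (rule that, assumption+)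
  have "u k x = u k z"
  proof (rule constant_if_constant_on_edges[OF _ verts])
    fix y z assume yz: "y \<rightarrow>\<^bsub>G\<^esub> z"
    then show "u k y = u k z"
      using A.extremal_eigvec_edge[of 1 "u k" y z] eig[of k] adj_in_verts[OF yz]
      by (simp add: adj_def)
  qed
  then have uk: "A.ip (u k) (u k) = 0"
    using proj[OF assms(2)] verts by (simp add: v_def A.ip_diff A.ip_unit)
  show thesis
  proof (rule ccontr)
    assume "\<not> thesis"
    then have "\<forall>t\<in>A.eigenvals. t \<noteq> real k \<longrightarrow> \<not> 0 \<le> t" using that by blast
    then have neg: "t < 0" if "t \<in> A.eigenvals" "t \<noteq> real k" for t
      using that by force
    have le: "t * A.ip (u t) (u t) \<le> 0" if "t \<in> A.eigenvals" for t
      using neg[OF that] uk A.ip_nonneg[of "u t"] by (cases "t = real k") (auto simp: mult_nonpos_nonneg)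
    have "(\<Sum>t\<in>A.eigenvals. - (t * A.ip (u t) (u t))) = 0"
      using u(2) vAv by (simp add: sum_negf)
    then have "\<forall>t\<in>A.eigenvals. - (t * A.ip (u t) (u t)) = 0"
      using le assms(1) by (subst (asm) sum_nonneg_eq_0_iff) auto
    then have "A.ip (u t) (u t) = 0" if "t \<in> A.eigenvals" for t
      using that uk neg[OF that] by (cases "t = real k") fastforce+
    then have "A.ip v v = 0" unfolding u(1) by simp
    then show False using vv by simp
  qed
qed

end

section \<open>The local graphs\<close>

locale two_walk_regular_spectrum = two_walk_regular_graph +
  fixes \<theta>1 \<theta>d :: real
  assumes finite_eigenvals: "finite A.eigenvals"
    and eigenval_k: "real k \<in> A.eigenvals"
    and eigenval_\<theta>1: "\<theta>1 \<in> A.eigenvals"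
    and eigenval_\<theta>d: "\<theta>d \<in> A.eigenvals"
    and \<theta>1_less_k: "\<theta>1 < real k"
    and \<theta>d_least: "s \<in> A.eigenvals \<Longrightarrow> \<theta>d \<le> s"
    and \<theta>1_greatest: "s \<in> A.eigenvals \<Longrightarrow> s \<noteq> real k \<Longrightarrow> s \<le> \<theta>1"
begin

lemma \<theta>d_less: "\<theta>d < -1"
proof -
  obtain t where "t \<in> A.eigenvals" "t < -1" using ex_eigenval_less_minus_1[OF finite_eigenvals] .
  then show ?thesis using \<theta>d_least[of t] by linarith
qed

lemma \<theta>1_nonneg: "\<theta>1 \<ge> 0"
proof -
  obtain s where "s \<in> A.eigenvals" "s \<noteq> real k" "s \<ge> 0"
    using ex_nonneg_eigenval[OF finite_eigenvals eigenval_k] .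
  then show ?thesis using \<theta>1_greatest[of s] by linarith
qed

definition lo :: real where "lo = -1 - b1 / (\<theta>1 + 1)"
definition hi :: real where "hi = -1 - b1 / (\<theta>d + 1)"

text \<open>Division by \<theta>1 + 1 > 0 turns the inequality for \<theta>1 into the lower bound;
  \<theta>d + 1 < 0 reverses the inequality for \<theta>d into the upper bound. The opposite signs
  also give lo < hi.\<close>

lemma local_matrix_neighbors:
  assumes x: "x \<in> verts G"
  shows "local_matrix (neighbors G x) (adj G) (real a1) lo hi"
proof -
  interpret L: regular_matrix "neighbors G x" "adj G" "real a1" by (rule regular_matrix_local)
  have form: "0 \<le> (\<theta> + 1 + b1) * L.ip w w + (\<theta> + 1) * L.ip w (L.app w)"
    if "\<theta> \<in> A.eigenvals" "\<theta> < real k" "L.sum_zero w" for \<theta> w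
    using local_form_nonneg[OF finite_eigenvals that(1,2) x, of w] that(3)
    by (simp add: L.ip_def L.app_def L.sum_zero_def)
  show ?thesis
  proof
    show "adj G y y = 0" for y using adj_not_same by (auto simp: adj_def)
    show "neighbors G x \<noteq> {}" using card_neighbors[OF x] a1_less by auto
    have "b1 / (\<theta>1 + 1) > 0" "b1 / (\<theta>d + 1) < 0"
      using b1_pos \<theta>1_nonneg \<theta>d_less by (auto simp: divide_pos_neg)
    then show "lo < hi" by (simp add: lo_def hi_def)
    fix w assume w: "L.sum_zero w"
    have "- ((\<theta>1 + 1 + b1) * L.ip w w) \<le> (\<theta>1 + 1) * L.ip w (L.app w)"
      using form[OF eigenval_\<theta>1 \<theta>1_less_k w] by simp
    moreover have "(\<theta>1 + 1) * (lo * L.ip w w) = - ((\<theta>1 + 1 + b1) * L.ip w w)"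
      using \<theta>1_nonneg by (simp add: lo_def field_simps)
    ultimately have "(\<theta>1 + 1) * (lo * L.ip w w) \<le> (\<theta>1 + 1) * L.ip w (L.app w)" by simp
    then show "lo * L.ip w w \<le> L.ip w (L.app w)"
      using \<theta>1_nonneg by (simp add: mult_le_cancel_left)
    have "- ((\<theta>d + 1 + b1) * L.ip w w) \<le> (\<theta>d + 1) * L.ip w (L.app w)"
      using form[OF eigenval_\<theta>d _ w] \<theta>d_less by simp
    moreover have "(\<theta>d + 1) * (hi * L.ip w w) = - ((\<theta>d + 1 + b1) * L.ip w w)"
      using \<theta>d_less by (simp add: hi_def field_simps)
    ultimately show "L.ip w (L.app w) \<le> hi * L.ip w w"
      using \<theta>d_less mult_le_cancel_left[of "\<theta>d + 1" "hi * L.ip w w" "L.ip w (L.app w)"] by simp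
  qed
qed

text \<open>Left side minus right side of the claimed bound.\<close>

definition slack :: real where
  "slack = (\<theta>1 + real k / (real a1 + 1)) * (\<theta>d + real k / (real a1 + 1))
    + real k * real a1 * b1 / (real a1 + 1)\<^sup>2"

text \<open>With p = \<theta>1 + 1 and q = \<theta>d + 1, clearing denominators on either side leads
  to the polynomial p q (a1 + 1) + b1 (p + q) + b1 (a1 + b1). The factor p q is negative, so a
  nonpositive gap means a nonnegative slack.\<close>

lemma slack_eq_gap:
  assumes x: "x \<in> verts G"
  shows "slack * (b1 * (real a1 + 1))
    = (\<theta>1 + 1) * (\<theta>d + 1) * (real k * local_matrix.gap (neighbors G x) (real a1) lo hi)"
proof -
  interpret L: local_matrix "neighbors G x" "adj G" "real a1" lo hi
    using local_matrix_neighbors[OF x] .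
  define p q where "p = \<theta>1 + 1" and "q = \<theta>d + 1"
  have pq: "p \<noteq> 0" "q \<noteq> 0" using \<theta>1_nonneg \<theta>d_less by (auto simp: p_def q_def)
  have kb: "real k = real a1 + 1 + b1" by (simp add: b1_def)
  have a: "real a1 + 1 \<noteq> 0" by linarith
  have k: "real k \<noteq> 0" using a1_less by simp
  have plo: "p * lo = - p - b1" and qhi: "q * hi = - q - b1"
    using pq unfolding lo_def hi_def p_def q_def by (simp_all add: field_simps)
  have "real k * L.gap = real k * (real a1 + lo * hi) - (real a1 - lo) * (real a1 - hi)"
    using k by (simp add: L.gap_def card_neighbors[OF x] field_simps)
  then have "p * q * (real k * L.gap)
      = p * q * (real k * (real a1 + lo * hi) - (real a1 - lo) * (real a1 - hi))" by simp
  also have "\<dots> = real k * (p * q * real a1 + (p * lo) * (q * hi)) - (p * real a1 - p * lo) * (q * real a1 - q * hi)"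
    by (simp add: algebra_simps)
  also have "\<dots> = b1 * (p * q * (real a1 + 1) + b1 * (p + q) + b1 * (real a1 + b1))"
    unfolding plo qhi kb by (simp add: algebra_simps)
  finally have gap: "p * q * (real k * L.gap) = \<dots>" .
  have "((s + K / A) * (t + K / A) + X / A\<^sup>2) * A\<^sup>2 = (s * A + K) * (t * A + K) + X"
    if "A \<noteq> 0" for s t A K X :: real
    using that by (simp add: field_simps power2_eq_square)
  from this[OF a] have "slack * (real a1 + 1)\<^sup>2
      = (\<theta>1 * (real a1 + 1) + real k) * (\<theta>d * (real a1 + 1) + real k) + real k * real a1 * b1"
    unfolding slack_def .
  also have "\<dots> = (p * (real a1 + 1) + b1) * (q * (real a1 + 1) + b1) + real k * real a1 * b1"
    by (simp add: p_def q_def kb algebra_simps)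
  also have "\<dots> = (real a1 + 1) * (p * q * (real a1 + 1) + b1 * (p + q) + b1 * (real a1 + b1))"
    unfolding kb by (simp add: algebra_simps)
  finally have "slack * (real a1 + 1) = p * q * (real a1 + 1) + b1 * (p + q) + b1 * (real a1 + b1)"
    using a by (simp add: power2_eq_square mult_ac)
  then show ?thesis using gap by (simp add: p_def q_def mult_ac)
qed

lemma verts_nonempty: "verts G \<noteq> {}"
proof -
  obtain x y z where "x \<rightarrow>\<^bsub>G\<^esub> y" "y \<rightarrow>\<^bsub>G\<^esub> z" "x \<noteq> z" "\<not> x \<rightarrow>\<^bsub>G\<^esub> z" using ex_distance_2 .
  then show ?thesis using adj_in_verts by blast
qed

lemma slack_nonneg: "slack \<ge> 0"
proof -
  obtain x where x: "x \<in> verts G" using verts_nonempty by blast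
  interpret L: local_matrix "neighbors G x" "adj G" "real a1" lo hi
    using local_matrix_neighbors[OF x] .
  have "0 \<le> (\<theta>1 + 1) * (\<theta>d + 1) * (real k * L.gap)"
    using L.gap_nonpos \<theta>1_nonneg \<theta>d_less by (intro mult_nonpos_nonpos) (auto simp: mult_le_0_iff)
  then have "0 \<le> slack * (b1 * (real a1 + 1))" unfolding slack_eq_gap[OF x] .
  moreover have "b1 * (real a1 + 1) > 0" using b1_pos by simp
  ultimately show ?thesis by (simp only: zero_le_mult_iff) linarith
qed

lemma slack_eq_0_iff:
  assumes x: "x \<in> verts G"
  shows "slack = 0 \<longleftrightarrow> local_matrix.gap (neighbors G x) (real a1) lo hi = 0"
proof -
  have "b1 * (real a1 + 1) \<noteq> 0" "(\<theta>1 + 1) * (\<theta>d + 1) * real k \<noteq> 0"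
    using b1_pos \<theta>1_nonneg \<theta>d_less a1_less by auto
  then show ?thesis using slack_eq_gap[OF x] by auto
qed

section \<open>The equality cases\<close>

lemma spectrum_local_graph:
  "graph_spectrum (local_graph G x) = symmetric_matrix.eigenvals (neighbors G x) (adj G)"
proof -
  have "symmetric_matrix (verts (local_graph G x)) (adj G)"
    by (simp add: verts_local_graph symmetric_matrix_adj)
  from graph_spectrum_eq_eigenvals(1)[OF this] show ?thesis
    by (simp add: verts_local_graph dominates_local_graph adj_def)
qed

lemma ex_neighbor_adjacent:
  assumes "a1 \<noteq> 0" "x \<in> verts G"
  obtains y z where "y \<in> neighbors G x" "z \<in> neighbors G x" "z \<in> neighbors G y"
proof -
  obtain y where y: "y \<in> neighbors G x" using card_neighbors[OF assms(2)] a1_less by fastforce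
  then have "neighbors G x \<inter> neighbors G y \<noteq> {}" using card_neighbors_Int[OF y] assms(1) by auto
  then show thesis using that y by blast
qed

text \<open>A neighbour y of x is adjacent to only a1 < k - 1 of the other neighbours of x. The
  nonedge keeps the local graph from being complete and makes both lo and hi occur as
  eigenvalues.\<close>

lemma ex_neighbor_nonadjacent:
  assumes "x \<in> verts G"
  obtains y z where "y \<in> neighbors G x" "z \<in> neighbors G x" "y \<noteq> z" "z \<notin> neighbors G y"
proof -
  obtain y where y: "y \<in> neighbors G x" using card_neighbors[OF assms] a1_less by fastforce
  have "\<not> neighbors G x \<subseteq> insert y (neighbors G x \<inter> neighbors G y)"
  proof
    assume "neighbors G x \<subseteq> insert y (neighbors G x \<inter> neighbors G y)"
    then have "card (neighbors G x) \<le> card (insert y (neighbors G x \<inter> neighbors G y))"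
      by (intro card_mono) auto
    also have "\<dots> \<le> a1 + 1"
      using card_insert_le_m1[of "a1 + 1"] card_neighbors_Int[OF y] by (simp add: card_insert_if)
    finally show False using a1_less card_neighbors[OF assms] by simp
  qed
  then show thesis using that[OF y] by blast
qed

lemma strongly_regular_local_graph:
  assumes x: "x \<in> verts G" and "a1 \<noteq> 0" "slack = 0"
  shows "strongly_regular (local_graph G x)"
proof -
  interpret L: local_matrix "neighbors G x" "adj G" "real a1" lo hi
    using local_matrix_neighbors[OF x] .
  have gap: "L.gap = 0" using slack_eq_0_iff[OF x] assms(3) by simp
  define c where "c = (real a1 - lo) * (real a1 - hi) / card (neighbors G x)"
  \<comment> \<open>The count is known as a real number; rounding turns it into a natural number
    that depends on y and z only through \<open>adj G y z\<close>, which takes one value on edges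
    and one on nonedges.\<close>
  have common: "card (common_neighbors (local_graph G x) y z) = nat \<lfloor>(lo + hi) * adj G y z + c\<rfloor>"
    if "y \<in> neighbors G x" "z \<in> neighbors G x" "y \<noteq> z" for y z
  proof -
    have "common_neighbors (local_graph G x) y z
        = neighbors G x \<inter> {u. u \<in> neighbors G y \<and> u \<in> neighbors G z}"
      using that by (auto simp: common_neighbors_def neighbors_local_graph)
    then have "real (card (common_neighbors (local_graph G x) y z))
        = (\<Sum>u\<in>neighbors G x. of_bool (u \<in> neighbors G y \<and> u \<in> neighbors G z))"
      by (simp add: sum_of_bool_eq)
    also have "\<dots> = (\<Sum>u\<in>neighbors G x. adj G y u * adj G u z)"
      by (intro sum.cong refl) (auto simp: adj_neighbors neighbors_sym[of z])
    also have "\<dots> = (lo + hi) * adj G y z + c"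
      using L.common_count_if_gap_eq_0[OF gap that] by (simp add: c_def)
    finally show ?thesis by (metis floor_of_nat nat_int)
  qed
  obtain y1 z1 where adj: "y1 \<in> neighbors G x" "z1 \<in> neighbors G x" "z1 \<in> neighbors G y1"
    using ex_neighbor_adjacent[OF assms(2) x] .
  obtain y2 z2 where nonadj: "y2 \<in> neighbors G x" "z2 \<in> neighbors G x" "y2 \<noteq> z2" "z2 \<notin> neighbors G y2"
    using ex_neighbor_nonadjacent[OF x] .
  show ?thesis
    unfolding strongly_regular_def verts_local_graph
  proof (intro conjI)
    show "graph (local_graph G x)" by (rule graph_local_graph)
    show "\<exists>y\<in>neighbors G x. \<exists>z\<in>neighbors G x. y \<rightarrow>\<^bsub>local_graph G x\<^esub> z"
      using adj by (auto simp: dominates_local_graph simp flip: mem_neighbors)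
    show "\<exists>y\<in>neighbors G x. \<exists>z\<in>neighbors G x. y \<noteq> z \<and> \<not> y \<rightarrow>\<^bsub>local_graph G x\<^esub> z"
      using nonadj by (auto simp: dominates_local_graph simp flip: mem_neighbors)
    have "regular_of_valency (local_graph G x) a1"
      by (simp add: regular_of_valency_def verts_local_graph neighbors_local_graph card_neighbors_Int)
    moreover have "card (common_neighbors (local_graph G x) y z) = nat \<lfloor>lo + hi + c\<rfloor>"
      if yz: "y \<in> neighbors G x" "z \<in> neighbors G x" and "y \<rightarrow>\<^bsub>local_graph G x\<^esub> z" for y z
    proof -
      have "z \<in> neighbors G y" using that by (simp add: dominates_local_graph mem_neighbors)
      moreover from this have "y \<noteq> z" using not_mem_neighbors_self by blast
      ultimately show ?thesis using common[OF yz] by (simp add: adj_neighbors)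
    qed
    moreover have "card (common_neighbors (local_graph G x) y z) = nat \<lfloor>c\<rfloor>"
      if yz: "y \<in> neighbors G x" "z \<in> neighbors G x" and "y \<noteq> z \<and> \<not> y \<rightarrow>\<^bsub>local_graph G x\<^esub> z" for y z
      using common[OF yz] that by (simp add: dominates_local_graph adj_def)
    ultimately show "\<exists>k l m. regular_of_valency (local_graph G x) k \<and>
        (\<forall>y\<in>neighbors G x. \<forall>z\<in>neighbors G x. y \<rightarrow>\<^bsub>local_graph G x\<^esub> z \<longrightarrow>
          card (common_neighbors (local_graph G x) y z) = l) \<and>
        (\<forall>y\<in>neighbors G x. \<forall>z\<in>neighbors G x. y \<noteq> z \<and> \<not> y \<rightarrow>\<^bsub>local_graph G x\<^esub> z \<longrightarrow>
          card (common_neighbors (local_graph G x) y z) = m)"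
      by blast
  qed
qed

lemma slack_eq_0_iff_local_spectrum:
  assumes x: "x \<in> verts G" and "a1 \<noteq> 0"
  shows "slack = 0 \<longleftrightarrow> graph_spectrum (local_graph G x) = {real a1, hi, lo}"
proof -
  interpret L: local_matrix "neighbors G x" "adj G" "real a1" lo hi
    using local_matrix_neighbors[OF x] .
  obtain y1 z1 where adj: "y1 \<in> neighbors G x" "z1 \<in> neighbors G x" "z1 \<in> neighbors G y1"
    using ex_neighbor_adjacent[OF assms(2) x] .
  obtain y2 z2 where nonadj: "y2 \<in> neighbors G x" "z2 \<in> neighbors G x" "y2 \<noteq> z2" "z2 \<notin> neighbors G y2"
    using ex_neighbor_nonadjacent[OF x] .
  have "L.gap = 0 \<longleftrightarrow> L.eigenvals = {real a1, lo, hi}"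
    using L.eigenvals_if_gap_eq_0[of y1 z1 y2 z2] L.gap_eq_0_if_eigenvals adj nonadj
    by (auto simp: adj_neighbors)
  then show ?thesis
    unfolding slack_eq_0_iff[OF x] spectrum_local_graph by (simp add: insert_commute)
qed

text \<open>A bipartition gives the sign vector as an eigenvector for -k. Conversely, an eigenvector
  for -k changes sign along every edge, so its absolute value is constant by connectedness and its
  signs define the two classes.\<close>

lemma bipartite_iff: "bipartite G \<longleftrightarrow> \<theta>d = - real k"
proof
  assume "bipartite G"
  then obtain U V where UV: "verts G = U \<union> V" "U \<inter> V = {}" "arcs_ends G \<subseteq> U \<times> V \<union> V \<times> U"
    unfolding bipartite_def by blast
  define v :: "'a \<Rightarrow> real" where "v x = (if x \<in> U then 1 else -1)" for x
  have "A.app v x = - real k * v x" if x: "x \<in> verts G" for x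
  proof -
    have "A.app v x = (\<Sum>y\<in>neighbors G x. - v x)"
      unfolding app_eq using UV(2,3) by (intro sum.cong refl) (auto simp: mem_neighbors v_def)
    then show ?thesis using x by (simp add: card_neighbors)
  qed
  then have "- real k \<in> A.eigenvals"
    using verts_nonempty by (auto simp: A.eigenvals_def A.eigvec_def v_def intro!: exI[of _ v])
  then have "\<theta>d \<le> - real k" by (rule \<theta>d_least)
  then show "\<theta>d = - real k" using A.abs_eigenval_le[OF eigenval_\<theta>d] by simp
next
  assume "\<theta>d = - real k"
  then obtain v x where v: "A.eigvec (-1 * real k) v" "x \<in> verts G" "v x \<noteq> 0"
    using eigenval_\<theta>d by (auto simp: A.eigenvals_def)
  have edge: "v y = - v z" if yz: "y \<rightarrow>\<^bsub>G\<^esub> z" for y z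
    using A.extremal_eigvec_edge[OF v(1), of y z] adj_in_verts[OF yz] yz by (simp add: adj_def)
  have nonzero: "v y \<noteq> 0" if "y \<in> verts G" for y
    using constant_if_constant_on_edges[of "\<lambda>y. \<bar>v y\<bar>" x y] edge v that by fastforce
  define U where "U = {y \<in> verts G. v y > 0}"
  define V where "V = {y \<in> verts G. v y < 0}"
  have "arcs_ends G \<subseteq> U \<times> V \<union> V \<times> U"
  proof
    fix e assume "e \<in> arcs_ends G"
    then obtain y z where e: "e = (y, z)" "y \<rightarrow>\<^bsub>G\<^esub> z" by (cases e) auto
    then show "e \<in> U \<times> V \<union> V \<times> U"
      using edge[OF e(2)] adj_in_verts[OF e(2)] nonzero[of y] by (auto simp: U_def V_def)
  qed
  moreover have "verts G = U \<union> V" using nonzero by (force simp: U_def V_def)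
  moreover have "U \<inter> V = {}" by (auto simp: U_def V_def)
  ultimately show "bipartite G" unfolding bipartite_def by blast
qed

text \<open>For a1 = 0 the slack is (\<theta>1 + k) (\<theta>d + k), whose first factor is
  positive.\<close>

lemma slack_eq_0_iff_bipartite:
  assumes "a1 = 0"
  shows "slack = 0 \<longleftrightarrow> bipartite G"
proof -
  have "slack = (\<theta>1 + real k) * (\<theta>d + real k)" using assms unfolding slack_def by simp
  moreover have "\<theta>1 + real k > 0" using \<theta>1_nonneg a1_less by simp
  ultimately show ?thesis unfolding bipartite_iff by (auto simp: add_eq_0_iff2)
qed

end

theorem theorem5p5:
  fixes G :: "('a, 'b) pre_digraph"
    and k a1 d :: nat
    and b1 :: real
    and \<theta> :: "nat \<Rightarrow> real"
  assumes "two_walk_regular G"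
    and "regular_of_valency G k"
    and "\<And>x y. x \<in> verts G \<Longrightarrow> y \<in> verts G \<Longrightarrow> x \<rightarrow>\<^bsub>G\<^esub> y \<Longrightarrow>
           card (common_neighbors G x y) = a1"
    and "b1 = real k - 1 - real a1"
    and "graph_spectrum G = \<theta> ` {0..d}"
    and "\<And>i j. i < j \<Longrightarrow> j \<le> d \<Longrightarrow> \<theta> j < \<theta> i"
    and "\<theta> 0 = real k"
  shows "(\<theta> 1 + real k / (real a1 + 1)) * (\<theta> d + real k / (real a1 + 1))
           \<ge> - (real k * real a1 * b1 / (real a1 + 1)\<^sup>2) \<and>
         (a1 \<noteq> 0 \<longrightarrow>
           ((\<theta> 1 + real k / (real a1 + 1)) * (\<theta> d + real k / (real a1 + 1))
              = - (real k * real a1 * b1 / (real a1 + 1)\<^sup>2) \<longleftrightarrow>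
            (\<forall>x \<in> verts G. strongly_regular (local_graph G x) \<and>
               graph_spectrum (local_graph G x)
                 = {real a1, -1 - b1 / (\<theta> d + 1), -1 - b1 / (\<theta> 1 + 1)}))) \<and>
         (a1 = 0 \<longrightarrow>
           ((\<theta> 1 + real k / (real a1 + 1)) * (\<theta> d + real k / (real a1 + 1))
              = - (real k * real a1 * b1 / (real a1 + 1)\<^sup>2) \<longleftrightarrow>
            bipartite G))"
proof -
  interpret graph G using assms(1) by (simp add: two_walk_regular_def)
  interpret W: two_walk_regular_graph G k a1
    using assms(1-3) by unfold_locales auto
  have eigenvals: "W.A.eigenvals = \<theta> ` {0..d}" "finite W.A.eigenvals"
    using graph_spectrum_eq_eigenvals[OF W.A.symmetric_matrix_axioms] assms(5)
    by (simp_all add: adj_def)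
  have k: "real k \<in> W.A.eigenvals" unfolding eigenvals(1) using assms(7) by (auto intro!: image_eqI[of _ _ 0])
  \<comment> \<open>This makes \<open>\<theta> 1\<close> an actual eigenvalue; for d = 0 its value
    would be unconstrained.\<close>
  have "d \<noteq> 0"
  proof
    assume "d = 0"
    then have "W.A.eigenvals = {real k}" using eigenvals assms(7) by simp
    then show False using W.ex_nonneg_eigenval[OF eigenvals(2) k] by auto
  qed
  have anti: "\<theta> j \<le> \<theta> i" if "i \<le> j" "j \<le> d" for i j
    using assms(6)[of i j] that by (cases "i = j") auto
  interpret S: two_walk_regular_spectrum G k a1 "\<theta> 1" "\<theta> d"
  proof
    show "\<theta> 1 < real k" using assms(6)[of 0 1] assms(7) \<open>d \<noteq> 0\<close> by simp
    show "\<theta> 1 \<in> W.A.eigenvals" "\<theta> d \<in> W.A.eigenvals" unfolding eigenvals(1) using \<open>d \<noteq> 0\<close> by auto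
    show "\<theta> d \<le> s" if "s \<in> W.A.eigenvals" for s using that anti unfolding eigenvals(1) by auto
    show "s \<le> \<theta> 1" if "s \<in> W.A.eigenvals" "s \<noteq> real k" for s
    proof -
      obtain i where i: "s = \<theta> i" "i \<le> d" using \<open>s \<in> W.A.eigenvals\<close> unfolding eigenvals(1) by auto
      then have "i \<noteq> 0" using assms(7) \<open>s \<noteq> real k\<close> by (cases i) auto
      then show ?thesis using anti[of 1 i] i by simp
    qed
  qed (use k eigenvals in auto)
  have b1: "b1 = W.b1" using assms(4) by (simp add: W.b1_def)
  have slack: "S.slack = (\<theta> 1 + real k / (real a1 + 1)) * (\<theta> d + real k / (real a1 + 1))
    - - (real k * real a1 * b1 / (real a1 + 1)\<^sup>2)"
    unfolding S.slack_def b1 by simp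
  \<comment> \<open>From right to left some vertex is needed to instantiate the quantifier, hence
    \<open>S.verts_nonempty\<close>.\<close>
  have "S.slack = 0 \<longleftrightarrow> (\<forall>x\<in>verts G. strongly_regular (local_graph G x) \<and>
      graph_spectrum (local_graph G x) = {real a1, S.hi, S.lo})" if "a1 \<noteq> 0"
    using S.slack_eq_0_iff_local_spectrum[OF _ that] S.strongly_regular_local_graph[OF _ that]
      S.verts_nonempty by blast
  then show ?thesis
    using S.slack_nonneg S.slack_eq_0_iff_bipartite
    unfolding slack S.lo_def S.hi_def b1 by auto
qed

end
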